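(* Let $n\ge1$ and let $\omega\in\mathbb{C}$ satisfy $\operatorname{Re}\omega>0$. Let $1\le q\le p\le+\infty$ and let $m\in\mathbb{Z}_{>0}$. Let $\theta\in(-\pi/2,\pi/2)$ with $e^{i\theta}=\omega/|\omega|$, and let $r\in[1,+\infty]$ with $1/p+1=1/r+1/q$. Then for every $\varphi\in L^{q}_{m}(\mathbb{R}^{n})$, $$\sum_{|\alpha|=m}\big\|[x^{\alpha},e^{\omega\Delta}]\varphi\big\|_{p}\le A_{m,r}(\theta)\,|\omega|^{-\frac n2\left(\frac1q-\frac1p\right)}\Big(|\omega|^{\frac12}\,\big\||x|^{m-1}\varphi\big\|_{q}+|\omega|^{\frac m2}\,\|\varphi\|_{q}\Big),$$ where $$A_{m,r}(\theta):=\frac{(n+m-1)!}{(n-1)!\,m!}\,(4\pi)^{-\frac n2\left(1-\frac1r\right)}\Big(\frac{2}{r\cos\theta}\Big)^{\frac{n}{2r}}\left\{\left[\Big(\frac{4m}{e\cos\theta}\Big)^{\frac12}+1\right]^{m}-1\right\}.$$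
   Context: Functions on $\mathbb{R}^n$ are complex-valued; $L^{q}(\mathbb{R}^{n})$ is the Lebesgue space with norm $\|\cdot\|_q$. For $m\in\mathbb{Z}_{>0}$, $$L^{q}_{m}(\mathbb{R}^{n}):=\{\varphi\in L^{q}(\mathbb{R}^{n}) : x^{\alpha}\varphi\in L^{q}(\mathbb{R}^{n})\text{ for all }\alpha\in\mathbb{Z}_{\ge0}^{n}\text{ with }|\alpha|\le m\},$$ where $x^{\alpha}\varphi$ denotes the function $x\mapsto x^{\alpha}\varphi(x)$. For $\omega\in\mathbb{C}\setminus\{0\}$ with $\operatorname{Re}\omega\ge 0$, the complex Gaussian kernel is $G_{\omega}(x):=(4\pi\omega)^{-n/2}\exp(-|x|^{2}/(4\omega))$, $x\in\mathbb{R}^{n}$ (principal branch of the power), and $e^{\omega\Delta}\varphi:=G_{\omega}*\varphi$ (convolution on $\mathbb{R}^{n}$). The commutator is $[x^{\alpha},e^{\omega\Delta}]\varphi:=x^{\alpha}e^{\omega\Delta}\varphi-e^{\omega\Delta}(x^{\alpha}\varphi)$. Sums over $|\alpha|=m$ run over multi-indices $\alpha\in\mathbb{Z}_{\ge0}^{n}$ with $|\alpha|=\sum_j\alpha_j=m$; $x^\alpha=\prod_jx_j^{\alpha_j}$. Conventions: $1/\infty=0$; when $r=+\infty$ the factor $\left(\frac{2}{r\cos\theta}\right)^{\frac{n}{2r}}$ is understood as its limit $1$. In the constant, $e$ is the base of the natural logarithm. *)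

theory Defs
  imports "HOL-Probability.Essential_Supremum"
begin

text \<open>
  Exponents in \<open>[1, \<infinity>]\<close> are of type \<^typ>\<open>ennreal\<close>, where \<open>1 / \<infinity> = 0\<close>.
  Functions are Lebesgue measurable representatives, not classes modulo null sets.
  A finite type \<open>'n\<close> indexes the coordinates, and the dimension is \<open>CARD('n)\<close>.
\<close>

definition Lq_norm :: "ennreal \<Rightarrow> (real^'n \<Rightarrow> complex) \<Rightarrow> ennreal" where
  "Lq_norm q f =
     (if q = \<infinity> then esssup lebesgue (\<lambda>x. ennreal (cmod (f x)))
      else let I = \<integral>\<^sup>+x. ennreal (cmod (f x) powr enn2real q) \<partial>lebesgue
           in if I = \<infinity> then \<infinity> else ennreal (enn2real I powr (1 / enn2real q)))"

definition Lq_space :: "ennreal \<Rightarrow> (real^'n \<Rightarrow> complex) set" where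
  "Lq_space q = {f. f \<in> borel_measurable lebesgue \<and> Lq_norm q f < \<infinity>}"

definition mi_abs :: "('n::finite \<Rightarrow> nat) \<Rightarrow> nat" where
  "mi_abs \<alpha> = (\<Sum>j\<in>UNIV. \<alpha> j)"

definition mono_pow :: "real^'n \<Rightarrow> ('n \<Rightarrow> nat) \<Rightarrow> real" where
  "mono_pow x \<alpha> = (\<Prod>j\<in>UNIV. (x $ j) ^ \<alpha> j)"

definition mono_mult :: "('n \<Rightarrow> nat) \<Rightarrow> (real^'n \<Rightarrow> complex) \<Rightarrow> (real^'n \<Rightarrow> complex)" where
  "mono_mult \<alpha> \<phi> = (\<lambda>x. complex_of_real (mono_pow x \<alpha>) * \<phi> x)"

definition Lq_weighted :: "ennreal \<Rightarrow> nat \<Rightarrow> (real^'n \<Rightarrow> complex) set" where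
  "Lq_weighted q m =
     {\<phi> \<in> Lq_space q. \<forall>\<alpha>. mi_abs \<alpha> \<le> m \<longrightarrow> mono_mult \<alpha> \<phi> \<in> Lq_space q}"

text \<open>The complex \<open>powr\<close> is the principal branch.\<close>

definition gauss_kernel :: "complex \<Rightarrow> real^'n \<Rightarrow> complex" where
  "gauss_kernel \<omega> x =
     (4 * of_real pi * \<omega>) powr (- of_nat CARD('n) / 2)
       * exp (- (of_real ((norm x)\<^sup>2) / (4 * \<omega>)))"

definition convol :: "(real^'n \<Rightarrow> complex) \<Rightarrow> (real^'n \<Rightarrow> complex) \<Rightarrow> (real^'n \<Rightarrow> complex)" where
  "convol f g = (\<lambda>x. LINT y|lebesgue. f (x - y) * g y)"

definition heat_op :: "complex \<Rightarrow> (real^'n \<Rightarrow> complex) \<Rightarrow> (real^'n \<Rightarrow> complex)" where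
  "heat_op \<omega> \<phi> = convol (gauss_kernel \<omega>) \<phi>"

definition heat_commutator ::
  "('n \<Rightarrow> nat) \<Rightarrow> complex \<Rightarrow> (real^'n \<Rightarrow> complex) \<Rightarrow> (real^'n \<Rightarrow> complex)" where
  "heat_commutator \<alpha> \<omega> \<phi> =
     (\<lambda>x. mono_mult \<alpha> (heat_op \<omega> \<phi>) x - heat_op \<omega> (mono_mult \<alpha> \<phi>) x)"

text \<open>For \<open>r = \<infinity>\<close> the second to last factor is taken to be its limit 1.\<close>

definition A_const :: "nat \<Rightarrow> nat \<Rightarrow> ennreal \<Rightarrow> real \<Rightarrow> real" where
  "A_const n m r \<theta> =
     fact (n + m - 1) / (fact (n - 1) * fact m)
     * (4 * pi) powr (- (real n / 2) * (1 - enn2real (1 / r)))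
     * (if r = \<infinity> then 1
        else (2 / (enn2real r * cos \<theta>)) powr (real n / (2 * enn2real r)))
     * ((sqrt (4 * real m / (exp 1 * cos \<theta>)) + 1) ^ m - 1)"

end

theory Submission
  imports Defs "HOL-Probability.Distributions"
begin

text \<open>
  With \<open>z = x - y\<close>, the commutator is the integral of
  \<open>G\<^sub>\<omega>(z) (x\<^sup>\<alpha> - y\<^sup>\<alpha>) \<phi>(y)\<close>, and \<open>|x\<^sup>\<alpha> - y\<^sup>\<alpha>| \<le> (|y| + |z|)\<^sup>m - |y|\<^sup>m\<close>.
  Half of the decay of \<open>|G\<^sub>\<omega>(z)| = (4 \<pi> |\<omega>|) powr (-n/2) exp (- cos \<theta> |z|\<^sup>2 / (4 |\<omega>|))\<close>
  absorbs each power of \<open>|z|\<close> at the cost of a factor \<open>sqrt (4 m |\<omega>| / (e cos \<theta>))\<close>, and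
  each mixed term \<open>|\<omega>| powr ((m - k) / 2) |y|\<^sup>k\<close> with \<open>k < m\<close> is at most
  \<open>|\<omega>| powr (1/2) |y| ^ (m - 1) + |\<omega>| powr (m/2)\<close>. So the commutator is dominated
  pointwise by the convolution of a real Gaussian, carrying the other half of the decay, with
  a weighted \<open>|\<phi>|\<close>. Young's convolution inequality, the triangle inequality in \<open>L\<^sup>q\<close>
  and the number of multi-indices of order \<open>m\<close> give the bound.
\<close>

section \<open>Multi-indices and monomials\<close>

text \<open>Stars and bars: an enumeration \<open>e\<close> of the coordinates, with inverse
  \<open>i\<close>, turns multi-indices of order \<open>m\<close> into lists of length
  \<open>CARD('n)\<close> with sum \<open>m\<close>, which \<open>card_length_sum_list\<close>
  counts.\<close>

lemma card_mi_abs: "card {\<alpha>::'n::finite \<Rightarrow> nat. mi_abs \<alpha> = m} = (m + CARD('n) - 1) choose m"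
proof -
  obtain e where e: "bij_betw e {..<CARD('n)} (UNIV :: 'n set)"
    using ex_bij_betw_nat_finite[of "UNIV :: 'n set"] by (auto simp: atLeast0LessThan)
  define i where "i = the_inv_into {..<CARD('n)} e"
  have i: "i j < CARD('n)" "e (i j) = j" for j
    using e unfolding i_def bij_betw_def
    by (metis UNIV_I lessThan_iff subset_refl the_inv_into_into, metis UNIV_I f_the_inv_into_f)
  have ie: "i (e k) = k" if "k < CARD('n)" for k
    using e that unfolding i_def bij_betw_def by (simp add: the_inv_into_f_f)
  have sum_e: "mi_abs \<alpha> = (\<Sum>k<CARD('n). \<alpha> (e k))" for \<alpha> :: "'n \<Rightarrow> nat"
    unfolding mi_abs_def using sum.reindex_bij_betw[OF e, of \<alpha>] by simp
  have "bij_betw (\<lambda>\<alpha>. map (\<lambda>k. \<alpha> (e k)) [0..<CARD('n)]) {\<alpha>::'n \<Rightarrow> nat. mi_abs \<alpha> = m}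
      {l. length l = CARD('n) \<and> sum_list l = m}"
  proof (rule bij_betw_byWitness[where f' = "\<lambda>l j. l ! i j"])
    show "(\<lambda>l j. l ! i j) ` {l. length l = CARD('n) \<and> sum_list l = m} \<subseteq> {\<alpha>::'n \<Rightarrow> nat. mi_abs \<alpha> = m}"
      by (auto simp: sum_e ie sum_list_sum_nth atLeast0LessThan)
  qed (auto simp: i ie sum_e interv_sum_list_conv_sum_set_nat atLeast0LessThan intro!: nth_equalityI)
  then show ?thesis
    by (simp add: bij_betw_same_card card_length_sum_list)
qed

text \<open>Domination of a value and of an increment is stable under products, by the discrete
  product rule. This is the induction step of the next two lemmas.\<close>

lemma abs_mult_diff_le:
  fixes u v u' v' :: real
  assumes "\<bar>u'\<bar> \<le> U'" "\<bar>u - u'\<bar> \<le> U - U'" "\<bar>v'\<bar> \<le> V'" "\<bar>v - v'\<bar> \<le> V - V'"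
  shows "\<bar>u * v - u' * v'\<bar> \<le> U * V - U' * V'"
proof -
  have "\<bar>u * v - u' * v'\<bar> = \<bar>(u - u') * v + u' * (v - v')\<bar>"
    by (simp add: algebra_simps)
  also have "\<dots> \<le> \<bar>u - u'\<bar> * \<bar>v\<bar> + \<bar>u'\<bar> * \<bar>v - v'\<bar>"
    using abs_triangle_ineq abs_mult by metis
  \<comment> \<open>The last two hypotheses add up to |v| \<le> \<open>V\<close>, and
    \<open>U - U'\<close> is nonnegative because it bounds an absolute value.\<close>
  also have "\<dots> \<le> (U - U') * V + U' * (V - V')"
    using assms by (intro add_mono mult_mono) auto
  finally show ?thesis
    by (simp add: algebra_simps)
qed

text \<open>Expanded in \<open>y\<close> and \<open>z\<close>, the difference is a polynomial with
  nonnegative coefficients, so passing to the bounds \<open>Y\<close> and \<open>Z\<close> can only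
  enlarge it.\<close>

lemma abs_power_diff_le:
  fixes y z Y Z :: real
  assumes "\<bar>y\<bar> \<le> Y" "\<bar>z\<bar> \<le> Z"
  shows "\<bar>(y + z) ^ k - y ^ k\<bar> \<le> (Y + Z) ^ k - Y ^ k"
proof (induction k)
  case (Suc k)
  have "\<bar>y ^ k\<bar> \<le> Y ^ k"
    using assms by (simp add: power_abs power_mono)
  then show ?case
    using abs_mult_diff_le[of y Y "y + z" "Y + Z", OF _ _ _ Suc] assms by simp
qed simp

text \<open>The bound on the product itself is carried along because the product rule in the
  induction step needs it.\<close>

lemma abs_prod_power_diff_le:
  fixes y z :: "'a \<Rightarrow> real"
  assumes "finite S" "\<And>j. j \<in> S \<Longrightarrow> \<bar>y j\<bar> \<le> Y" "\<And>j. j \<in> S \<Longrightarrow> \<bar>z j\<bar> \<le> Z"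
  shows "\<bar>\<Prod>j\<in>S. y j ^ \<alpha> j\<bar> \<le> Y ^ sum \<alpha> S \<and>
    \<bar>(\<Prod>j\<in>S. (y j + z j) ^ \<alpha> j) - (\<Prod>j\<in>S. y j ^ \<alpha> j)\<bar> \<le> (Y + Z) ^ sum \<alpha> S - Y ^ sum \<alpha> S"
  using assms
proof (induction S)
  case (insert i S)
  have 1: "\<bar>y i ^ \<alpha> i\<bar> \<le> Y ^ \<alpha> i"
    using insert.prems by (simp add: power_abs power_mono)
  have 2: "\<bar>(y i + z i) ^ \<alpha> i - y i ^ \<alpha> i\<bar> \<le> (Y + Z) ^ \<alpha> i - Y ^ \<alpha> i"
    using insert.prems by (simp add: abs_power_diff_le)
  have 3: "\<bar>\<Prod>j\<in>S. y j ^ \<alpha> j\<bar> \<le> Y ^ sum \<alpha> S"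
    and 4: "\<bar>(\<Prod>j\<in>S. (y j + z j) ^ \<alpha> j) - (\<Prod>j\<in>S. y j ^ \<alpha> j)\<bar> \<le> (Y + Z) ^ sum \<alpha> S - Y ^ sum \<alpha> S"
    using insert by auto
  have "\<bar>y i ^ \<alpha> i\<bar> * \<bar>\<Prod>j\<in>S. y j ^ \<alpha> j\<bar> \<le> Y ^ \<alpha> i * Y ^ sum \<alpha> S"
    by (rule mult_mono[OF 1 3]) (use 1 in auto)
  then show ?case
    using abs_mult_diff_le[OF 1 2 3 4] insert.hyps by (simp add: power_add abs_mult)
qed simp

lemma abs_mono_pow_diff_le:
  fixes x y :: "real^'n"
  shows "\<bar>mono_pow x \<alpha> - mono_pow y \<alpha>\<bar>
    \<le> (norm y + norm (x - y)) ^ mi_abs \<alpha> - norm y ^ mi_abs \<alpha>"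
  using abs_prod_power_diff_le[of UNIV "\<lambda>j. y $ j" "norm y" "\<lambda>j. (x - y) $ j" "norm (x - y)" \<alpha>]
  \<comment> \<open>The component rule is withheld at first so that
    \<open>component_le_norm_cart\<close> applies to \<open>x - y\<close>; only then is the sum of
    the components of \<open>y\<close> and \<open>x - y\<close> simplified.\<close>
  by (simp add: mono_pow_def mi_abs_def component_le_norm_cart del: vector_minus_component)
     (simp add: algebra_simps)

section \<open>Absorbing powers into the Gaussian and summing the binomial terms\<close>

lemma power_times_gauss_le:
  fixes c t :: real
  assumes "c > 0" "t \<ge> 0" "l \<le> m"
  shows "t ^ l * exp (- (c * t\<^sup>2 / 8)) \<le> sqrt (4 * real m / (exp 1 * c)) ^ l"
proof (cases "l = 0")
  case True
  then show ?thesis using assms by simp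
next
  case False
  \<comment> \<open>With this \<open>u\<close>, the left side of the claim is the
    \<open>l\<close>-th power of \<open>t * exp (- (u / 2))\<close>, whose square is controlled by u
    exp(-u) \<le> 1/e. The constant found has \<open>l\<close> in place of \<open>m\<close>;
    enlarging it to \<open>m\<close> gives one base for all \<open>l\<close>.\<close>
  define u where "u = c * t\<^sup>2 / (4 * real l)"
  have t2: "t\<^sup>2 = 4 * real l / c * u"
    using assms False by (simp add: u_def)
  have "u * exp (- u) \<le> exp (- 1)"
    using exp_ge_add_one_self[of "u - 1"] by (simp add: exp_diff exp_minus field_simps)
  then have "4 * real l / c * (u * exp (- u)) \<le> 4 * real l / c * exp (- 1)"
    using assms by (intro mult_left_mono) auto
  also have "\<dots> \<le> 4 * real m / (exp 1 * c)"
    using assms by (simp add: exp_minus field_simps)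
  finally have "(t * exp (- (u / 2)))\<^sup>2 \<le> 4 * real m / (exp 1 * c)"
    by (simp add: power_mult_distrib t2 mult.assoc flip: exp_of_nat_mult)
  then have "t * exp (- (u / 2)) \<le> sqrt (4 * real m / (exp 1 * c))"
    using real_le_rsqrt by blast
  then have "(t * exp (- (u / 2))) ^ l \<le> sqrt (4 * real m / (exp 1 * c)) ^ l"
    using assms by (intro power_mono) auto
  moreover have "exp (- (u / 2)) ^ l = exp (- (c * t\<^sup>2 / 8))"
    using False by (simp add: u_def flip: exp_of_nat_mult)
  ultimately show ?thesis
    by (simp add: power_mult_distrib)
qed

text \<open>Since \<open>k < m\<close>, one factor \<open>s\<close> can be split off. What remains
  has total degree \<open>m - 1\<close>, so it is at most the (m-1)-th power of the larger of
  \<open>s\<close> and \<open>Y\<close>.\<close>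

lemma power_mult_power_le_add:
  fixes s Y :: real
  assumes "s \<ge> 0" "Y \<ge> 0" "k < m"
  shows "s ^ (m - k) * Y ^ k \<le> s * Y ^ (m - 1) + s ^ m"
proof -
  have m: "m - k = Suc (m - 1 - k)" "m = Suc (m - 1)" and k: "m - 1 = (m - 1 - k) + k"
    using assms by auto
  define M where "M = max s Y"
  have "s ^ (m - 1 - k) * Y ^ k \<le> M ^ (m - 1 - k) * M ^ k"
    unfolding M_def using assms by (intro mult_mono power_mono) auto
  also have "\<dots> = M ^ (m - 1)"
    using k by (metis power_add)
  also have "\<dots> \<le> Y ^ (m - 1) + s ^ (m - 1)"
    unfolding M_def max_def using assms by auto
  finally have "s * (s ^ (m - 1 - k) * Y ^ k) \<le> s * (Y ^ (m - 1) + s ^ (m - 1))"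
    using assms by (intro mult_left_mono) auto
  also have "\<dots> = s * Y ^ (m - 1) + s ^ m"
    by (subst (4) m(2)) (simp add: algebra_simps)
  finally show ?thesis
    by (simp add: m(1) mult.assoc)
qed

text \<open>\<open>E\<close> stands for the full Gaussian decay and \<open>E'\<close> for the half
  that survives the absorption of \<open>Z ^ l\<close>. The bound for the mixed terms does not
  depend on \<open>k\<close>, so the remaining sum is again a binomial expansion without its top
  term, now of \<open>(1 + a) ^ m\<close>.\<close>

lemma binomial_diff_le:
  fixes s a Y Z E E' :: real
  assumes "s \<ge> 0" "a \<ge> 0" "Y \<ge> 0" "Z \<ge> 0" "E' \<ge> 0"
    and EZ: "\<And>l. l \<le> m \<Longrightarrow> Z ^ l * E \<le> (a * s) ^ l * E'"
  shows "((Y + Z) ^ m - Y ^ m) * E \<le> ((a + 1) ^ m - 1) * E' * (s * Y ^ (m - 1) + s ^ m)"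
proof -
  have split: "(w + v) ^ m - w ^ m = (\<Sum>k<m. real (m choose k) * w ^ k * v ^ (m - k))" for w v :: real
    by (simp add: binomial_ring lessThan_Suc_atMost[symmetric])
  have "((Y + Z) ^ m - Y ^ m) * E = (\<Sum>k<m. real (m choose k) * (Y ^ k * (Z ^ (m - k) * E)))"
    unfolding split sum_distrib_right by (intro sum.cong) (simp_all add: mult_ac)
  also have "\<dots> \<le> (\<Sum>k<m. real (m choose k) * (a ^ (m - k) * E' * (s * Y ^ (m - 1) + s ^ m)))"
  proof (intro sum_mono mult_left_mono)
    fix k assume "k \<in> {..<m}"
    then have k: "k < m" by simp
    have "Y ^ k * (Z ^ (m - k) * E) \<le> Y ^ k * ((a * s) ^ (m - k) * E')"
      using assms by (intro mult_left_mono) auto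
    also have "\<dots> = a ^ (m - k) * E' * (s ^ (m - k) * Y ^ k)"
      by (simp add: power_mult_distrib mult_ac)
    also have "\<dots> \<le> a ^ (m - k) * E' * (s * Y ^ (m - 1) + s ^ m)"
      using assms k by (intro mult_left_mono power_mult_power_le_add) auto
    finally show "Y ^ k * (Z ^ (m - k) * E) \<le> a ^ (m - k) * E' * (s * Y ^ (m - 1) + s ^ m)" .
  qed simp
  also have "\<dots> = (\<Sum>k<m. real (m choose k) * 1 ^ k * a ^ (m - k)) * (E' * (s * Y ^ (m - 1) + s ^ m))"
    unfolding sum_distrib_right by (intro sum.cong) (simp_all add: mult_ac)
  also have "\<dots> = ((a + 1) ^ m - 1) * E' * (s * Y ^ (m - 1) + s ^ m)"
    by (subst split[symmetric]) (simp add: add.commute)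
  finally show ?thesis .
qed

section \<open>Gaussian integrals\<close>

lemma nn_integral_gauss_real:
  fixes a :: real
  assumes "a > 0"
  shows "(\<integral>\<^sup>+x. ennreal (exp (- (a * x\<^sup>2))) \<partial>lborel) = ennreal (sqrt (pi / a))"
proof -
  \<comment> \<open>The variance 1/(2a) makes the integrand a multiple of a normal density, whose
    integral is 1.\<close>
  define \<sigma> where "\<sigma> = sqrt (1 / (2 * a))"
  have \<sigma>: "\<sigma> > 0" "\<sigma>\<^sup>2 = 1 / (2 * a)"
    using assms by (auto simp: \<sigma>_def)
  have "exp (- (a * x\<^sup>2)) = sqrt (pi / a) * normal_density 0 \<sigma> x" for x
    using assms by (simp add: normal_density_def \<sigma>(2) real_sqrt_divide field_simps)
  then have "(\<integral>\<^sup>+x. ennreal (exp (- (a * x\<^sup>2))) \<partial>lborel)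
      = ennreal (sqrt (pi / a)) * (\<integral>\<^sup>+x. ennreal (normal_density 0 \<sigma> x) \<partial>lborel)"
    using assms by (simp add: ennreal_mult' nn_integral_cmult)
  also have "(\<integral>\<^sup>+x. ennreal (normal_density 0 \<sigma> x) \<partial>lborel) = 1"
    using \<sigma> by (simp add: nn_integral_eq_integral)
  finally show ?thesis by simp
qed

lemma nn_integral_gauss:
  fixes a :: real
  assumes "a > 0"
  shows "(\<integral>\<^sup>+x. ennreal (exp (- (a * (norm x)\<^sup>2))) \<partial>(lborel :: 'a::euclidean_space measure))
    = ennreal ((pi / a) powr (real DIM('a) / 2))"
proof -
  have "exp (- (a * (norm x)\<^sup>2)) = (\<Prod>b\<in>Basis. exp (- (a * (x \<bullet> b)\<^sup>2)))" for x :: 'a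
  proof -
    have "(norm x)\<^sup>2 = (\<Sum>b\<in>Basis. (x \<bullet> b)\<^sup>2)"
      unfolding power2_norm_eq_inner euclidean_inner[of x x] by (simp add: power2_eq_square)
    then show ?thesis
      by (simp add: exp_sum[symmetric] sum_negf sum_distrib_left)
  qed
  then have "(\<integral>\<^sup>+x. ennreal (exp (- (a * (norm x)\<^sup>2))) \<partial>(lborel :: 'a measure))
      = (\<integral>\<^sup>+x. (\<Prod>b\<in>Basis. ennreal (exp (- (a * (x \<bullet> b)\<^sup>2)))) \<partial>(lborel :: 'a measure))"
    by (simp add: prod_ennreal)
  also have "\<dots> = (\<Prod>b\<in>(Basis::'a set). ennreal (sqrt (pi / a)))"
    by (subst nn_integral_lborel_prod) (simp_all add: nn_integral_gauss_real[OF assms])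
  also have "\<dots> = ennreal (sqrt (pi / a) ^ DIM('a))"
    using assms by (simp add: ennreal_power)
  also have "sqrt (pi / a) ^ DIM('a) = (pi / a) powr (real DIM('a) / 2)"
    using assms by (simp add: powr_half_sqrt[symmetric] powr_powr flip: powr_realpow)
  finally show ?thesis .
qed

section \<open>Young's convolution inequality\<close>

lemma nn_integral_lborel_reflect:
  fixes x :: "'a::euclidean_space"
  assumes [measurable]: "f \<in> borel_measurable borel"
  shows "(\<integral>\<^sup>+y. f (x - y) \<partial>lborel) = (\<integral>\<^sup>+y. f y \<partial>lborel)"
proof -
  have "(\<integral>\<^sup>+y. f y \<partial>lborel) = (\<integral>\<^sup>+y. f y \<partial>(density (distr lborel borel (\<lambda>y. x + (-1) *\<^sub>R y)) (\<lambda>_. ennreal (\<bar>-1\<bar>^DIM('a)))))"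
    by (subst lborel_affine[of "-1" x]) simp_all
  also have "\<dots> = (\<integral>\<^sup>+y. f (x - y) \<partial>lborel)"
    by (simp add: nn_integral_density nn_integral_distr)
  finally show ?thesis by simp
qed

lemma AE_lborel_reflect:
  fixes x :: "'a::euclidean_space"
  assumes [measurable]: "Measurable.pred borel P" and P: "AE y in lborel. P y"
  shows "AE y in lborel. P (x - y)"
proof -
  have "(\<integral>\<^sup>+y. indicator {y. \<not> P y} y \<partial>lborel) = 0"
    using P by (subst nn_integral_0_iff_AE) (auto simp: indicator_def)
  then have "(\<integral>\<^sup>+y. indicator {y. \<not> P y} (x - y) \<partial>lborel) = 0"
    by (subst nn_integral_lborel_reflect) auto
  then have "AE y in lborel. indicator {y. \<not> P y} (x - y) = (0::ennreal)"
    by (subst (asm) nn_integral_0_iff_AE) auto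
  then show ?thesis
    by eventually_elim (auto simp: indicator_def split: if_splits)
qed

text \<open>A translation is a composition of two reflections.\<close>

lemma nn_integral_lborel_shift:
  fixes x :: "'a::euclidean_space"
  assumes [measurable]: "f \<in> borel_measurable borel"
  shows "(\<integral>\<^sup>+y. f (y - x) \<partial>lborel) = (\<integral>\<^sup>+y. f y \<partial>lborel)"
  using nn_integral_lborel_reflect[of "\<lambda>y. f (- y)" x] nn_integral_lborel_reflect[of f 0] by simp

section \<open>Monotonicity, scaling and the triangle inequality for the L^q norm\<close>

lemma Lq_norm_AE_mono:
  assumes "f \<in> borel_measurable lebesgue" "AE x in lebesgue. cmod (f x) \<le> cmod (g x)"
  shows "Lq_norm q f \<le> Lq_norm q g"
proof (cases "q = \<infinity>")
  case True
  have "AE x in lebesgue. ennreal (cmod (f x)) \<le> ennreal (cmod (g x))"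
    using assms(2) by eventually_elim (simp add: ennreal_leI)
  then show ?thesis
    using assms(1) True unfolding Lq_norm_def by (simp add: esssup_AE_mono)
next
  case False
  have le: "(\<integral>\<^sup>+x. ennreal (cmod (f x) powr enn2real q) \<partial>lebesgue)
      \<le> (\<integral>\<^sup>+x. ennreal (cmod (g x) powr enn2real q) \<partial>lebesgue)" (is "?I \<le> ?J")
    using assms(2) by (intro nn_integral_mono_AE, eventually_elim) (auto intro!: ennreal_leI powr_mono2)
  show ?thesis
  proof (cases "?J = \<infinity>")
    case False
    with le have "?I \<noteq> \<infinity>" by (auto simp: top_unique)
    moreover have "enn2real ?I \<le> enn2real ?J"
      using le False by (simp add: enn2real_mono less_top)
    ultimately show ?thesis
      using False \<open>q \<noteq> \<infinity>\<close> by (auto simp: Lq_norm_def Let_def intro!: ennreal_leI powr_mono2)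
  qed (use False in \<open>simp add: Lq_norm_def\<close>)
qed

lemma Lq_norm_AE_cong:
  assumes "f \<in> borel_measurable lebesgue" "g \<in> borel_measurable lebesgue"
    "AE x in lebesgue. cmod (f x) = cmod (g x)"
  shows "Lq_norm q f = Lq_norm q g"
  using assms by (intro antisym Lq_norm_AE_mono) auto

text \<open>The interface to the definition for finite exponents: later estimates compare q-th
  powers under \<open>lborel\<close> and avoid the case split and the root. If the integral is
  infinite, both sides are false.\<close>

lemma Lq_norm_le_iff:
  assumes "q > 0" "C \<ge> 0"
  shows "Lq_norm (ennreal q) f \<le> ennreal C \<longleftrightarrow>
    (\<integral>\<^sup>+x. ennreal (cmod (f x) powr q) \<partial>lborel) \<le> ennreal (C powr q)"
proof (cases "(\<integral>\<^sup>+x. ennreal (cmod (f x) powr q) \<partial>lborel)")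
  case (real t)
  have "t powr (1 / q) \<le> C \<longleftrightarrow> (t powr (1 / q)) powr q \<le> C powr q"
    using assms by (metis linorder_not_less powr_ge_zero powr_less_mono2 powr_mono2 less_imp_le)
  then show ?thesis
    using real assms by (simp add: Lq_norm_def nn_integral_completion powr_powr)
qed (use assms in \<open>simp add: Lq_norm_def nn_integral_completion top_unique\<close>)

lemma AE_le_Lq_norm_infinity: "AE x in lebesgue. ennreal (cmod (f x)) \<le> Lq_norm \<infinity> f"
  using esssup_AE[of "\<lambda>x. ennreal (cmod (f x))" lebesgue] by (simp add: Lq_norm_def)

lemma Lq_norm_infinity_le:
  assumes "f \<in> borel_measurable lebesgue" "AE x in lebesgue. ennreal (cmod (f x)) \<le> C"
  shows "Lq_norm \<infinity> f \<le> C"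
  using assms unfolding Lq_norm_def by (simp add: esssup_I)

lemma Lq_norm_eq_0_AE:
  assumes "f \<in> borel_measurable lebesgue" "Lq_norm q f = 0" "q \<ge> 1"
  shows "AE x in lebesgue. f x = 0"
proof (cases "q = \<infinity>")
  case True
  then show ?thesis using AE_le_Lq_norm_infinity[of f] assms by simp
next
  case False
  then obtain q' where q: "q = ennreal q'" "q' \<ge> 0" by (cases q) auto
  with assms have "q' \<ge> 1" by simp
  then have "(\<integral>\<^sup>+x. ennreal (cmod (f x) powr q') \<partial>lebesgue) = 0"
    using Lq_norm_le_iff[of q' 0 f] assms q by (simp add: nn_integral_completion)
  then show ?thesis
    using assms by (subst (asm) nn_integral_0_iff_AE) (auto elim!: eventually_mono)
qed

lemma Lq_norm_scale:
  assumes "f \<in> borel_measurable lebesgue" "q \<ge> 1" "c \<ge> 0"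
  shows "Lq_norm q (\<lambda>x. of_real c * f x) \<le> ennreal c * Lq_norm q f"
proof (cases "q = \<infinity>")
  case True
  have "AE x in lebesgue. ennreal (cmod (of_real c * f x)) \<le> ennreal c * Lq_norm \<infinity> f"
    using AE_le_Lq_norm_infinity[of f]
    by eventually_elim (use assms in \<open>simp add: norm_mult ennreal_mult mult_left_mono\<close>)
  then show ?thesis
    unfolding True using assms(1) by (intro Lq_norm_infinity_le) auto
next
  case False
  then obtain q' where q: "q = ennreal q'" "q' \<ge> 0" by (cases q) auto
  with assms have q': "q' \<ge> 1" by simp
  note [measurable] = assms(1)
  show ?thesis
  \<comment> \<open>Here \<open>Lq_norm q f\<close> may be infinite, and since
    \<open>0 * \<infinity> = 0\<close> the left side must be shown to vanish.\<close>
  proof (cases "c = 0")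
    case True
    then show ?thesis
      using Lq_norm_le_iff[of q' 0 "\<lambda>x. of_real c * f x"] q q' by simp
  next
    case False
    show ?thesis
    proof (cases "Lq_norm q f")
      case (real C)
      have le: "(\<integral>\<^sup>+x. ennreal (cmod (f x) powr q') \<partial>lebesgue) \<le> ennreal (C powr q')"
        using Lq_norm_le_iff[of q' C f] q q' real by (simp add: nn_integral_completion)
      have "(\<integral>\<^sup>+x. ennreal (cmod (of_real c * f x) powr q') \<partial>lebesgue)
          = ennreal (c powr q') * (\<integral>\<^sup>+x. ennreal (cmod (f x) powr q') \<partial>lebesgue)"
        using assms by (simp add: norm_mult powr_mult ennreal_mult nn_integral_cmult)
      also have "\<dots> \<le> ennreal (c powr q') * ennreal (C powr q')"
        by (intro mult_left_mono le) simp
      also have "\<dots> = ennreal ((c * C) powr q')"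
        using assms real by (simp add: powr_mult ennreal_mult)
      finally show ?thesis
        using Lq_norm_le_iff[of q' "c * C" "\<lambda>x. of_real c * f x"] q q' assms real
        by (simp add: ennreal_mult nn_integral_completion)
    qed (use False assms in \<open>simp add: ennreal_mult_top\<close>)
  qed
qed

text \<open>Convexity is applied at positive arguments only. If \<open>u\<close> or \<open>v\<close>
  is zero, the claim reduces to s^p \<le> s for 0 < s < 1, and likewise for
  \<open>t\<close>.\<close>

lemma powr_convex_combination:
  fixes s t u v p :: real
  assumes "p \<ge> 1" "u \<ge> 0" "v \<ge> 0" "s > 0" "t > 0" "s + t = 1"
  shows "(s * u + t * v) powr p \<le> s * u powr p + t * v powr p"
proof -
  have "s powr p \<le> s" "t powr p \<le> t"
    using assms powr_mono'[of 1 p s] powr_mono'[of 1 p t] by auto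
  then have *: "(s * w) powr p \<le> s * w powr p" "(t * w) powr p \<le> t * w powr p" if "w \<ge> 0" for w
    using assms that by (auto simp: powr_mult intro!: mult_right_mono)
  consider "u = 0" | "v = 0" | "u > 0" "v > 0"
    using assms by linarith
  then show ?thesis
  proof cases
    case 3
    then show ?thesis
      using convex_onD[OF powr_convex[OF \<open>p \<ge> 1\<close>], of t u v] assms by (simp add: eq_diff_eq[symmetric])
  qed (use assms * in auto)
qed

text \<open>Minkowski's inequality from convexity of the power. Infinite norms are trivial, and
  norms equal to zero are split off because the main case divides by both norms.\<close>

lemma Lq_norm_triangle:
  assumes [measurable]: "f \<in> borel_measurable lebesgue" "g \<in> borel_measurable lebesgue"
    and "h \<in> borel_measurable lebesgue"
    and le: "\<And>x. cmod (h x) \<le> cmod (f x) + cmod (g x)" and "q \<ge> 1"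
  shows "Lq_norm q h \<le> Lq_norm q f + Lq_norm q g"
proof -
  consider "Lq_norm q f = \<infinity> \<or> Lq_norm q g = \<infinity>" | "Lq_norm q f = 0" | "Lq_norm q g = 0"
    | "q = \<infinity>"
    | "q \<noteq> \<infinity>" "Lq_norm q f \<noteq> \<infinity>" "Lq_norm q f \<noteq> 0" "Lq_norm q g \<noteq> \<infinity>" "Lq_norm q g \<noteq> 0"
    by blast
  then show ?thesis
  proof cases
    case 2
    then have "AE x in lebesgue. f x = 0"
      using assms Lq_norm_eq_0_AE by blast
    then have "AE x in lebesgue. cmod (h x) \<le> cmod (g x)"
      by eventually_elim (use le in \<open>metis add_0 norm_zero\<close>)
    then show ?thesis
      using Lq_norm_AE_mono[of h g q] assms 2 by simp
  next
    case 3
    then have "AE x in lebesgue. g x = 0"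
      using assms Lq_norm_eq_0_AE by blast
    then have "AE x in lebesgue. cmod (h x) \<le> cmod (f x)"
      by eventually_elim (use le in \<open>metis add.right_neutral norm_zero\<close>)
    then show ?thesis
      using Lq_norm_AE_mono[of h f q] assms 3 by simp
  next
    case 4
    have "AE x in lebesgue. ennreal (cmod (h x)) \<le> Lq_norm \<infinity> f + Lq_norm \<infinity> g"
      using AE_le_Lq_norm_infinity[of f] AE_le_Lq_norm_infinity[of g]
    proof eventually_elim
      case (elim x)
      have "ennreal (cmod (h x)) \<le> ennreal (cmod (f x)) + ennreal (cmod (g x))"
        using le[of x] by (simp flip: ennreal_plus)
      also have "\<dots> \<le> Lq_norm \<infinity> f + Lq_norm \<infinity> g"
        using elim by (rule add_mono)
      finally show ?case .
    qed
    then show ?thesis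
      unfolding 4 by (intro Lq_norm_infinity_le assms)
  next
    case 5
    then obtain q' where q: "q = ennreal q'" "q' \<ge> 0" by (cases q) auto
    with assms have q': "q' \<ge> 1" by simp
    from 5 obtain A B where A: "Lq_norm q f = ennreal A" "A > 0" and B: "Lq_norm q g = ennreal B" "B > 0"
      by (cases "Lq_norm q f"; cases "Lq_norm q g") (auto simp: less_le)
    have fA: "(\<integral>\<^sup>+x. ennreal (cmod (f x) powr q') \<partial>lebesgue) \<le> ennreal (A powr q')"
      and gB: "(\<integral>\<^sup>+x. ennreal (cmod (g x) powr q') \<partial>lebesgue) \<le> ennreal (B powr q')"
      using Lq_norm_le_iff[of q' A f] Lq_norm_le_iff[of q' B g] q q' A B
      by (simp_all add: nn_integral_completion)
    \<comment> \<open>With these weights, |f| + |g| is \<open>A + B\<close> times a convex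
      combination of the normalised functions |f|/A and |g|/B.\<close>
    define s where "s = A / (A + B)"
    define t where "t = B / (A + B)"
    define K where "K = (A + B) powr q'"
    have st: "s > 0" "t > 0" "s + t = 1"
      using A B by (auto simp: s_def t_def add_divide_distrib[symmetric])
    have K: "K > 0" using A B by (simp add: K_def)
    have ABst: "(A + B) * (s * (u / A) + t * (v / B)) = u + v" for u v
    proof -
      have "(A + B) * s = A" "(A + B) * t = B"
        using A B by (auto simp: s_def t_def)
      then have "(A + B) * (s * (u / A) + t * (v / B)) = A * (u / A) + B * (v / B)"
        by (metis distrib_left mult.assoc)
      then show ?thesis using A B by simp
    qed
    have "cmod (h x) powr q' \<le> K * s / A powr q' * cmod (f x) powr q' + K * t / B powr q' * cmod (g x) powr q'" for x
    proof -
      have "cmod (h x) powr q' \<le> ((A + B) * (s * (cmod (f x) / A) + t * (cmod (g x) / B))) powr q'"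
        using q' by (intro powr_mono2) (simp_all only: ABst le, simp_all)
      also have "\<dots> = K * (s * (cmod (f x) / A) + t * (cmod (g x) / B)) powr q'"
        using A B st by (simp add: K_def powr_mult)
      also have "\<dots> \<le> K * (s * (cmod (f x) / A) powr q' + t * (cmod (g x) / B) powr q')"
        using A B st K q' by (intro mult_left_mono powr_convex_combination) auto
      also have "\<dots> = K * s / A powr q' * cmod (f x) powr q' + K * t / B powr q' * cmod (g x) powr q'"
        using A B by (simp add: powr_divide algebra_simps)
      finally show ?thesis .
    qed
    then have "(\<integral>\<^sup>+x. ennreal (cmod (h x) powr q') \<partial>lebesgue)
      \<le> (\<integral>\<^sup>+x. ennreal (K * s / A powr q') * ennreal (cmod (f x) powr q')
            + ennreal (K * t / B powr q') * ennreal (cmod (g x) powr q') \<partial>lebesgue)"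
      using K st by (intro nn_integral_mono) (simp flip: ennreal_mult ennreal_plus)
    also have "\<dots> = ennreal (K * s / A powr q') * (\<integral>\<^sup>+x. ennreal (cmod (f x) powr q') \<partial>lebesgue)
            + ennreal (K * t / B powr q') * (\<integral>\<^sup>+x. ennreal (cmod (g x) powr q') \<partial>lebesgue)"
      by (simp add: nn_integral_add nn_integral_cmult)
    also have "\<dots> \<le> ennreal (K * s / A powr q') * ennreal (A powr q')
            + ennreal (K * t / B powr q') * ennreal (B powr q')"
      by (intro add_mono mult_left_mono fA gB) simp_all
    also have "\<dots> = ennreal (K * (s + t))"
      using A B st(1,2) K by (simp add: distrib_left flip: ennreal_mult ennreal_plus)
    finally have "(\<integral>\<^sup>+x. ennreal (cmod (h x) powr q') \<partial>lebesgue) \<le> ennreal ((A + B) powr q')"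
      by (simp add: st K_def)
    then have "Lq_norm q h \<le> ennreal (A + B)"
      using Lq_norm_le_iff[of q' "A + B" h] q q' A B by (simp add: nn_integral_completion)
    then show ?thesis
      using A B by simp
  qed auto
qed

section \<open>Weighted means and Hoelder's inequality\<close>

lemma weighted_geometric_mean_le:
  fixes a b c x y z :: real
  assumes "a \<ge> 0" "b \<ge> 0" "c \<ge> 0" "a + b + c = 1" "x \<ge> 0" "y \<ge> 0" "z \<ge> 0"
  shows "x powr a * y powr b * z powr c \<le> a * x + b * y + c * z"
proof (cases "x = 0 \<or> y = 0 \<or> z = 0")
  case True
  \<comment> \<open>In HOL \<open>0 powr 0 = 0\<close>, so the left side vanishes even when the zero
    factor has exponent 0.\<close>
  then show ?thesis using assms by auto
next
  case False
  with assms have pos: "x > 0" "y > 0" "z > 0" by auto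
  define M where "M = a * x + b * y + c * z"
  have "M > 0"
  proof -
    have "a * x \<ge> 0" "b * y \<ge> 0" "c * z \<ge> 0" "a > 0 \<or> b > 0 \<or> c > 0"
      using assms by auto
    moreover have "a > 0 \<Longrightarrow> a * x > 0" "b > 0 \<Longrightarrow> b * y > 0" "c > 0 \<Longrightarrow> c * z > 0"
      using pos by auto
    ultimately show ?thesis
      unfolding M_def by linarith
  qed
  \<comment> \<open>The tangent of the logarithm is taken at the arithmetic mean \<open>M\<close>,
    so that the weighted sum of the right sides is zero.\<close>
  have ln_le: "w * (ln v - ln M) \<le> w * (v / M - 1)" if "w \<ge> 0" "v > 0" for v w
    using ln_le_minus_one[of "v / M"] that \<open>M > 0\<close> by (intro mult_left_mono) (auto simp: ln_div)
  have "a * (ln x - ln M) + b * (ln y - ln M) + c * (ln z - ln M)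
      \<le> a * (x / M - 1) + b * (y / M - 1) + c * (z / M - 1)"
    using ln_le assms pos by (intro add_mono) auto
  also have "\<dots> = (a * x + b * y + c * z) / M - (a + b + c)"
    by (simp add: add_divide_distrib algebra_simps)
  also have "\<dots> = 0" using \<open>M > 0\<close> assms by (simp flip: M_def)
  finally have "a * ln x + b * ln y + c * ln z \<le> (a + b + c) * ln M"
    by (simp add: algebra_simps)
  then have "exp (a * ln x + b * ln y + c * ln z) \<le> exp (ln M)"
    using assms by simp
  then show ?thesis
    using pos \<open>M > 0\<close> by (simp add: exp_add powr_def M_def)
qed


text \<open>The three-factor Hoelder inequality for
  \<open>u v = (u\<^sup>r v\<^sup>q)\<^sup>a (u\<^sup>r)\<^sup>b (v\<^sup>q)\<^sup>c\<close>. For \<open>a = 0\<close> it is the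
  two-factor one, and the integral of the first factor need not be finite.\<close>

lemma nn_integral_mult_le_three_powr:
  fixes u v :: "'a \<Rightarrow> real"
  assumes [measurable]: "u \<in> borel_measurable M" "v \<in> borel_measurable M"
    and nonneg: "\<And>y. u y \<ge> 0" "\<And>y. v y \<ge> 0"
    and abc: "a \<ge> 0" "b \<ge> 0" "c \<ge> 0" "a + b + c = 1" "r * (a + b) = 1" "q * (a + c) = 1"
    and pos: "A > 0" "B > 0" "U > 0"
    and u: "(\<integral>\<^sup>+y. ennreal (u y powr r) \<partial>M) \<le> ennreal (A powr r)"
    and v: "(\<integral>\<^sup>+y. ennreal (v y powr q) \<partial>M) \<le> ennreal (B powr q)"
    and uv: "a > 0 \<Longrightarrow> (\<integral>\<^sup>+y. ennreal (u y powr r * v y powr q) \<partial>M) \<le> ennreal U"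
  shows "(\<integral>\<^sup>+y. ennreal (u y * v y) \<partial>M) \<le> ennreal (U powr a * A powr (r * b) * B powr (q * c))"
proof -
  define K where "K = U powr a * A powr (r * b) * B powr (q * c)"
  have K: "K > 0" using pos by (simp add: K_def)
  \<comment> \<open>The mean inequality is applied to the three factors divided by the bounds
    \<open>U\<close>, \<open>A powr r\<close>, \<open>B powr q\<close> of their integrals. After
    integration each term contributes at most \<open>K\<close> times its weight, and the weights sum
    to 1.\<close>
  have "u y * v y \<le> K * a / U * (u y powr r * v y powr q) + K * b / A powr r * u y powr r + K * c / B powr q * v y powr q"
    (is "_ \<le> ?R") for y
  proof (cases "u y = 0 \<or> v y = 0")
    case True
    then show ?thesis
      using nonneg[of y] abc pos K by auto
  next
    case False
    then have uv: "u y > 0" "v y > 0" using nonneg[of y] by auto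
    have "u y * v y = u y powr (r * (a + b)) * v y powr (q * (a + c))"
      using abc uv by simp
    also have "\<dots> = (u y powr r * v y powr q) powr a * (u y powr r) powr b * (v y powr q) powr c"
      using uv by (simp add: powr_mult powr_powr distrib_left powr_add)
    also have "\<dots> = K * (((u y powr r * v y powr q) / U) powr a * (u y powr r / A powr r) powr b * (v y powr q / B powr q) powr c)"
      using uv pos by (simp add: K_def powr_divide powr_powr)
    also have "\<dots> \<le> K * (a * ((u y powr r * v y powr q) / U) + b * (u y powr r / A powr r) + c * (v y powr q / B powr q))"
      using K abc pos by (intro mult_left_mono weighted_geometric_mean_le) auto
    also have "\<dots> = ?R"
      by (simp add: algebra_simps)
    finally show ?thesis .
  qed
  then have "(\<integral>\<^sup>+y. ennreal (u y * v y) \<partial>M)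
      \<le> (\<integral>\<^sup>+y. ennreal (K * a / U) * ennreal (u y powr r * v y powr q)
          + ennreal (K * b / A powr r) * ennreal (u y powr r) + ennreal (K * c / B powr q) * ennreal (v y powr q) \<partial>M)"
    using K abc pos by (intro nn_integral_mono) (simp flip: ennreal_mult ennreal_plus)
  also have "\<dots> = ennreal (K * a / U) * (\<integral>\<^sup>+y. ennreal (u y powr r * v y powr q) \<partial>M)
      + ennreal (K * b / A powr r) * (\<integral>\<^sup>+y. ennreal (u y powr r) \<partial>M)
      + ennreal (K * c / B powr q) * (\<integral>\<^sup>+y. ennreal (v y powr q) \<partial>M)"
    by (simp add: nn_integral_add nn_integral_cmult)
  also have "\<dots> \<le> ennreal (K * a / U) * ennreal U + ennreal (K * b / A powr r) * ennreal (A powr r)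
      + ennreal (K * c / B powr q) * ennreal (B powr q)"
  proof (intro add_mono mult_left_mono[OF u] mult_left_mono[OF v])
    show "ennreal (K * a / U) * (\<integral>\<^sup>+y. ennreal (u y powr r * v y powr q) \<partial>M) \<le> ennreal (K * a / U) * ennreal U"
      using abc(1) uv by (cases "a = 0") (auto intro!: mult_left_mono)
  qed simp_all
  also have "\<dots> = ennreal (K * (a + b + c))"
    using K abc(1-3) pos by (simp add: distrib_left flip: ennreal_mult ennreal_plus)
  finally show ?thesis
    by (simp add: abc K_def)
qed

lemma Lq_norm_reflect:
  fixes f :: "real^'n \<Rightarrow> complex"
  assumes [measurable]: "f \<in> borel_measurable borel"
  shows "Lq_norm q (\<lambda>y. f (x - y)) = Lq_norm q f"
proof -
  have le: "Lq_norm q (\<lambda>y. g (x - y)) \<le> Lq_norm q g" if [measurable]: "g \<in> borel_measurable borel" 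
    for g :: "real^'n \<Rightarrow> complex"
  proof (cases "q = \<infinity>")
    case True
    have "AE y in lborel. ennreal (cmod (g y)) \<le> Lq_norm \<infinity> g"
      using AE_le_Lq_norm_infinity[of g] by (simp add: AE_completion_iff)
    then have "AE y in lborel. ennreal (cmod (g (x - y))) \<le> Lq_norm \<infinity> g"
      by (rule AE_lborel_reflect[rotated]) measurable
    then show ?thesis
      unfolding True by (intro Lq_norm_infinity_le measurable_completion AE_completion) simp_all
  next
    case False
    then show ?thesis
      using nn_integral_lborel_reflect[of "\<lambda>y. ennreal (cmod (g y) powr enn2real q)" x]
      by (simp add: Lq_norm_def nn_integral_completion)
  qed
  \<comment> \<open>Reflection is an involution, so the same inequality for the reflected function
    is the reverse one.\<close>
  show ?thesis
    using le[of f] le[of "\<lambda>y. f (x - y)"] by simp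
qed

lemma nn_integral_mult_le_Lq_norm_infinity:
  fixes f g :: "real^'n \<Rightarrow> complex"
  assumes [measurable]: "g \<in> borel_measurable borel"
  shows "(\<integral>\<^sup>+y. ennreal (cmod (f y) * cmod (g y)) \<partial>lborel) \<le> Lq_norm \<infinity> f * Lq_norm 1 g"
proof -
  have "(\<integral>\<^sup>+y. ennreal (cmod (f y) * cmod (g y)) \<partial>lborel)
      \<le> (\<integral>\<^sup>+y. Lq_norm \<infinity> f * ennreal (cmod (g y)) \<partial>lborel)"
    using AE_le_Lq_norm_infinity[of f] unfolding AE_completion_iff
    by (intro nn_integral_mono_AE, eventually_elim) (simp add: ennreal_mult mult_right_mono)
  also have "\<dots> = Lq_norm \<infinity> f * (\<integral>\<^sup>+y. ennreal (cmod (g y)) \<partial>lborel)"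
    by (simp add: nn_integral_cmult)
  also have "(\<integral>\<^sup>+y. ennreal (cmod (g y)) \<partial>lborel) = Lq_norm 1 g"
    by (cases "\<integral>\<^sup>+y. ennreal (cmod (g y)) \<partial>lborel") (auto simp: Lq_norm_def nn_integral_completion)
  finally show ?thesis .
qed

text \<open>Hoelder with weights 1/p, 1/r - 1/p and 1/q - 1/p bounds |h|^p pointwise by a constant
  times \<open>U\<close>, the convolution of |f|^r and |g|^q. Tonelli then integrates
  \<open>U\<close> to a product.\<close>

lemma young_convolution_real:
  fixes f g h :: "real^'n \<Rightarrow> complex"
  assumes [measurable]: "f \<in> borel_measurable borel" "g \<in> borel_measurable borel"
    and h: "\<And>x. ennreal (cmod (h x)) \<le> (\<integral>\<^sup>+y. ennreal (cmod (f (x - y)) * cmod (g y)) \<partial>lborel)"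
    and pqr: "q \<ge> 1" "p \<ge> 1" "r \<ge> 1" "1 / p + 1 = 1 / r + 1 / q"
    and A: "(\<integral>\<^sup>+y. ennreal (cmod (f y) powr r) \<partial>lborel) \<le> ennreal (A powr r)" "A > 0"
    and B: "(\<integral>\<^sup>+y. ennreal (cmod (g y) powr q) \<partial>lborel) \<le> ennreal (B powr q)" "B > 0"
  shows "(\<integral>\<^sup>+x. ennreal (cmod (h x) powr p) \<partial>lborel) \<le> ennreal ((A * B) powr p)"
proof -
  define a where "a = 1 / p"
  define b where "b = 1 / r - 1 / p"
  define c where "c = 1 / q - 1 / p"
  have "1 / q \<le> 1" "1 / r \<le> 1" using pqr by auto
  then have abc: "a > 0" "b \<ge> 0" "c \<ge> 0" "a + b + c = 1" "r * (a + b) = 1" "q * (a + c) = 1"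
    using pqr unfolding a_def b_def c_def by (linarith | simp)+
  have bc: "r * b * p = p - r" "q * c * p = p - q"
    using pqr by (simp_all add: b_def c_def field_simps)
  have reflect: "(\<integral>\<^sup>+y. ennreal (cmod (f (x - y)) powr r) \<partial>lborel) \<le> ennreal (A powr r)" for x
    using A nn_integral_lborel_reflect[of "\<lambda>y. ennreal (cmod (f y) powr r)" x] by simp
  define U where "U x = (\<integral>\<^sup>+y. ennreal (cmod (f (x - y)) powr r * cmod (g y) powr q) \<partial>lborel)" for x
  \<comment> \<open>This is the p-th power of the last two factors in the Hoelder bound, simplified
    by \<open>bc\<close>.\<close>
  define K where "K = A powr (p - r) * B powr (p - q)"
  have K: "K > 0" using A B by (simp add: K_def)
  have "ennreal (cmod (h x) powr p) \<le> ennreal K * U x" for x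
  proof (cases "U x")
    case top
    then show ?thesis using K by (simp add: ennreal_mult_top)
  next
    case (real V)
    show ?thesis
    \<comment> \<open>The Hoelder lemma divides by its bound for the first integral, so a vanishing
      \<open>U x\<close> is treated apart: the integrand is then zero almost everywhere.\<close>
    proof (cases "V = 0")
      case True
      then have "U x = 0" using real by simp
      then have "AE y in lborel. cmod (f (x - y)) powr r * cmod (g y) powr q \<le> 0"
        unfolding U_def by (subst (asm) nn_integral_0_iff_AE) (auto simp: ennreal_eq_0_iff)
      then have "AE y in lborel. ennreal (cmod (f (x - y)) * cmod (g y)) = 0"
        by eventually_elim (auto simp: mult_le_0_iff)
      then have "(\<integral>\<^sup>+y. ennreal (cmod (f (x - y)) * cmod (g y)) \<partial>lborel) = 0"
        by (subst nn_integral_0_iff_AE) auto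
      then show ?thesis
        using h[of x] by simp
    next
      case False
      then have V: "V > 0" using real by simp
      have "(\<integral>\<^sup>+y. ennreal (cmod (f (x - y)) * cmod (g y)) \<partial>lborel)
        \<le> ennreal (V powr a * A powr (r * b) * B powr (q * c))"
        using abc A B V reflect[of x] real U_def[of x] by (intro nn_integral_mult_le_three_powr) auto
      then have "ennreal (cmod (h x)) \<le> ennreal (V powr a * A powr (r * b) * B powr (q * c))"
        using h[of x] by (rule order_trans[rotated])
      then have "cmod (h x) \<le> V powr a * A powr (r * b) * B powr (q * c)"
        by (subst (asm) ennreal_le_iff) auto
      then have "cmod (h x) powr p \<le> (V powr a * A powr (r * b) * B powr (q * c)) powr p"
        using pqr by (intro powr_mono2) auto
      also have "\<dots> = K * V"
        using V pqr by (simp add: powr_mult powr_powr bc K_def a_def)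
      finally show ?thesis
        using real K by (simp add: ennreal_leI flip: ennreal_mult)
    qed
  qed
  then have "(\<integral>\<^sup>+x. ennreal (cmod (h x) powr p) \<partial>lborel) \<le> (\<integral>\<^sup>+x. ennreal K * U x \<partial>lborel)"
    by (rule nn_integral_mono)
  also have "\<dots> = ennreal K * (\<integral>\<^sup>+x. U x \<partial>lborel)"
    unfolding U_def by (rule nn_integral_cmult) measurable
  also have "(\<integral>\<^sup>+x. U x \<partial>lborel)
      = (\<integral>\<^sup>+y. \<integral>\<^sup>+x. ennreal (cmod (f (x - y)) powr r * cmod (g y) powr q) \<partial>lborel \<partial>lborel)"
    unfolding U_def by (rule lborel_pair.Fubini'[symmetric]) measurable
  also have "\<dots> = (\<integral>\<^sup>+y. (\<integral>\<^sup>+x. ennreal (cmod (f x) powr r) \<partial>lborel) * ennreal (cmod (g y) powr q) \<partial>lborel)"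
    using nn_integral_lborel_shift[of "\<lambda>y. ennreal (cmod (f y) powr r)"]
    by (simp add: ennreal_mult nn_integral_multc)
  also have "\<dots> = (\<integral>\<^sup>+x. ennreal (cmod (f x) powr r) \<partial>lborel) * (\<integral>\<^sup>+y. ennreal (cmod (g y) powr q) \<partial>lborel)"
    by (simp add: nn_integral_cmult)
  also have "ennreal K * \<dots> \<le> ennreal K * (ennreal (A powr r) * ennreal (B powr q))"
    by (intro mult_mono mult_left_mono A B) simp_all
  also have "\<dots> = ennreal ((A * B) powr p)"
    using A B K by (simp add: K_def powr_mult powr_diff flip: ennreal_mult)
  finally show ?thesis .
qed

lemma one_divide_ennreal: "x \<ge> 1 \<Longrightarrow> 1 / ennreal x = ennreal (1 / x)"
  using divide_ennreal[of 1 x] by simp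

text \<open>The function \<open>h\<close> need only be dominated by the convolution of the moduli,
  as the commutator will be. Zero and infinite norms are removed first; then p = \<infinity> is
  Hoelder's inequality at each point, and finite \<open>p\<close> forces finite \<open>q\<close> and
  \<open>r\<close>.\<close>

lemma young_convolution:
  fixes f g h :: "real^'n \<Rightarrow> complex"
  assumes [measurable]: "f \<in> borel_measurable borel" "g \<in> borel_measurable borel"
    and hm: "h \<in> borel_measurable lebesgue"
    and h: "\<And>x. ennreal (cmod (h x)) \<le> (\<integral>\<^sup>+y. ennreal (cmod (f (x - y)) * cmod (g y)) \<partial>lborel)"
    and q: "1 \<le> q" and p: "1 \<le> p" and r: "1 \<le> r" and pqr: "1 / p + 1 = 1 / r + 1 / q"
  shows "Lq_norm p h \<le> Lq_norm r f * Lq_norm q g"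
proof -
  consider "Lq_norm r f = 0 \<or> Lq_norm q g = 0"
    | "Lq_norm r f \<noteq> 0" "Lq_norm q g \<noteq> 0" "Lq_norm r f = \<infinity> \<or> Lq_norm q g = \<infinity>"
    | A B where "Lq_norm r f = ennreal A" "A > 0" "Lq_norm q g = ennreal B" "B > 0"
    by (cases "Lq_norm r f"; cases "Lq_norm q g") (auto simp: less_le)
  then show ?thesis
  proof cases
    case 1
    have "(\<integral>\<^sup>+y. ennreal (cmod (f (x - y)) * cmod (g y)) \<partial>lborel) = 0" for x
    proof -
      have "AE y in lborel. f (x - y) = 0 \<or> g y = 0"
        using 1
      proof
        assume "Lq_norm r f = 0"
        then have "AE y in lebesgue. f (x - y) = 0"
          using Lq_norm_eq_0_AE[of "\<lambda>y. f (x - y)" r] r by (simp add: Lq_norm_reflect measurable_completion)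
        then show ?thesis
          unfolding AE_completion_iff by eventually_elim simp
      next
        assume "Lq_norm q g = 0"
        then have "AE y in lebesgue. g y = 0"
          using Lq_norm_eq_0_AE[of g q] q by (simp add: measurable_completion)
        then show ?thesis
          unfolding AE_completion_iff by eventually_elim simp
      qed
      then have "AE y in lborel. ennreal (cmod (f (x - y)) * cmod (g y)) = 0"
        by eventually_elim auto
      then show ?thesis
        by (subst nn_integral_0_iff_AE) auto
    qed
    then have h0: "h x = 0" for x
      using h[of x] by simp
    \<comment> \<open>The zero function is written as a multiple by 0 so that
      \<open>Lq_norm_scale\<close> evaluates its norm for every \<open>p\<close>.\<close>
    have "Lq_norm p h \<le> Lq_norm p (\<lambda>x::real^'n. of_real 0 * (0::complex))"
      by (intro Lq_norm_AE_mono hm) (simp add: h0)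
    also have "\<dots> = 0"
      using Lq_norm_scale[of "\<lambda>x. 0" p 0] p by simp
    finally show ?thesis by simp
  next
    case 2
    then show ?thesis by (auto simp: ennreal_top_mult ennreal_mult_top)
  next
    case (3 A B)
    show ?thesis
    proof (cases "p = \<infinity>")
      case True
      have rq: "1 = 1 / r + 1 / q"
        using pqr True by simp
      have "(\<integral>\<^sup>+y. ennreal (cmod (f (x - y)) * cmod (g y)) \<partial>lborel) \<le> Lq_norm r f * Lq_norm q g" for x
      proof -
        consider "r = \<infinity>" "q = 1" | "q = \<infinity>" "r = 1" | r' q' where "r = ennreal r'" "q = ennreal q'" "r' \<ge> 1" "q' \<ge> 1" "1 / r' + 1 / q' = 1"
        proof (cases r; cases q)
          fix r' q' assume r': "0 \<le> r'" "r = ennreal r'" and q': "0 \<le> q'" "q = ennreal q'"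
          then have "r' \<ge> 1" "q' \<ge> 1" using r q by simp_all
          moreover from this have "1 / r' + 1 / q' = 1"
            using rq r' q' by (simp add: one_divide_ennreal flip: ennreal_plus)
          ultimately show ?thesis using that(3) r' q' by blast
        next
          fix r' assume r': "0 \<le> r'" "r = ennreal r'" "q = top"
          then have "r' \<ge> 1" using r by simp
          then have "1 / r' = 1" using rq r' by (simp add: one_divide_ennreal)
          then show ?thesis using that(2) r' by simp
        next
          fix q' assume q': "0 \<le> q'" "q = ennreal q'" "r = top"
          then have "q' \<ge> 1" using q by simp
          then have "1 / q' = 1" using rq q' by (simp add: one_divide_ennreal)
          then show ?thesis using that(1) q' by simp
        qed (use rq in simp)
        then show ?thesis
        proof cases
          case 1
          then show ?thesis
            using nn_integral_mult_le_Lq_norm_infinity[of g "\<lambda>y. f (x - y)"] by (simp add: Lq_norm_reflect)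
        next
          case 2
          then show ?thesis
            using nn_integral_mult_le_Lq_norm_infinity[of "\<lambda>y. f (x - y)" g] by (simp add: Lq_norm_reflect mult.commute)
        next
          case (3 r' q')
          have "(\<integral>\<^sup>+y. ennreal (cmod (f (x - y)) powr r') \<partial>lborel) \<le> ennreal (A powr r')"
            "(\<integral>\<^sup>+y. ennreal (cmod (g y) powr q') \<partial>lborel) \<le> ennreal (B powr q')"
            using Lq_norm_le_iff[of r' A "\<lambda>y. f (x - y)"] Lq_norm_le_iff[of q' B g] 3
              \<open>Lq_norm r f = _\<close> \<open>Lq_norm q g = _\<close> \<open>A > 0\<close> \<open>B > 0\<close> by (simp_all add: Lq_norm_reflect)
          \<comment> \<open>Two-factor Hoelder is the case \<open>a = 0\<close>, b = 1/r', c = 1/q';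
            the value 1 for \<open>U\<close> is a placeholder.\<close>
          then have "(\<integral>\<^sup>+y. ennreal (cmod (f (x - y)) * cmod (g y)) \<partial>lborel)
             \<le> ennreal (1 powr 0 * A powr (r' * (1 / r')) * B powr (q' * (1 / q')))"
            using 3 \<open>A > 0\<close> \<open>B > 0\<close> by (intro nn_integral_mult_le_three_powr) auto
          then show ?thesis
            using 3 \<open>Lq_norm r f = _\<close> \<open>Lq_norm q g = _\<close> \<open>A > 0\<close> \<open>B > 0\<close> by (simp add: ennreal_mult)
        qed
      qed
      then have "ennreal (cmod (h x)) \<le> Lq_norm r f * Lq_norm q g" for x
        using h[of x] by (rule order_trans[rotated])
      then show ?thesis
        unfolding True by (intro Lq_norm_infinity_le hm) simp
    next
      case False
      obtain p' q' r' where *: "p = ennreal p'" "q = ennreal q'" "r = ennreal r'" "p' \<ge> 1" "q' \<ge> 1" "r' \<ge> 1"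
        "1 / p' + 1 = 1 / r' + 1 / q'"
      proof -
        obtain p' where p': "p = ennreal p'" "p' \<ge> 1"
          using False p by (cases p) auto
        have le1: "1 / s \<le> 1" if "s \<ge> 1" for s :: ennreal
          using that by (cases s) (auto simp: one_divide_ennreal)
        have sum: "ennreal (1 / p' + 1) = 1 / r + 1 / q"
          using pqr p' by (simp add: one_divide_ennreal)
        \<comment> \<open>For finite \<open>p\<close> the two reciprocals sum to more than 1 while
          each is at most 1, so neither is zero.\<close>
        then have "\<not> 1 / r + 1 / q \<le> 1"
          using p'(2) by (metis add_le_same_cancel2 ennreal_le_1 not_one_le_zero divide_le_0_1_iff order_trans)
        then have "r \<noteq> \<infinity>" "q \<noteq> \<infinity>"
          using le1[OF q] le1[OF r] by auto
        then obtain r' q' where r': "r = ennreal r'" "r' \<ge> 1" and q': "q = ennreal q'" "q' \<ge> 1"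
          using q r by (cases q; cases r) auto
        have "1 / p' + 1 = 1 / r' + 1 / q'"
        proof -
          have "ennreal (1 / p' + 1) = ennreal (1 / r' + 1 / q')"
            using sum q' r' by (simp add: one_divide_ennreal)
          then show ?thesis
            using p' q' r' by (subst (asm) ennreal_inj) simp_all
        qed
        then show ?thesis using that p' q' r' by blast
      qed
      have "(\<integral>\<^sup>+x. ennreal (cmod (h x) powr p') \<partial>lborel) \<le> ennreal ((A * B) powr p')"
        using young_convolution_real[of f g h q' p' r' A B] h * 3
          Lq_norm_le_iff[of r' A f] Lq_norm_le_iff[of q' B g] by simp
      then show ?thesis
        using Lq_norm_le_iff[of p' "A * B" h] * 3 by (simp add: ennreal_mult)
    qed
  qed
qed

section \<open>The heat commutator\<close>

lemma borel_measurable_gauss_kernel [measurable]: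
  "gauss_kernel \<omega> \<in> borel_measurable (borel :: (real^'n) measure)"
  unfolding gauss_kernel_def[abs_def]
  by (cases "\<omega> = 0") (auto intro!: borel_measurable_continuous_onI continuous_intros)

lemma borel_measurable_mono_pow [measurable]:
  "(\<lambda>x::real^'n. mono_pow x \<alpha>) \<in> borel_measurable borel"
  unfolding mono_pow_def by (intro borel_measurable_continuous_onI continuous_intros)

lemma mono_mult_measurable:
  "\<phi> \<in> borel_measurable borel \<Longrightarrow> mono_mult \<alpha> \<phi> \<in> borel_measurable (borel :: (real^'n) measure)"
  unfolding mono_mult_def[abs_def] by measurable

text \<open>The exponent of the prefactor is real, so its modulus does not see the argument of
  \<omega>; the modulus of the exponential depends only on the real part of 1/\<omega>.\<close>

lemma cmod_gauss_kernel:
  fixes x :: "real^'n"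
  assumes "Re \<omega> > 0"
  shows "cmod (gauss_kernel \<omega> x) = (4 * pi * cmod \<omega>) powr (- (real CARD('n) / 2))
    * exp (- (Re \<omega> / (cmod \<omega>)\<^sup>2 * (norm x)\<^sup>2 / 4))"
proof -
  have "cmod ((4 * of_real pi * \<omega>) powr (- of_nat CARD('n) / 2)) = (4 * pi * cmod \<omega>) powr (- (real CARD('n) / 2))"
    by (subst norm_powr_real_powr') (auto simp: norm_mult)
  moreover have "Re (of_real ((norm x)\<^sup>2) / (4 * \<omega>)) = Re \<omega> / (cmod \<omega>)\<^sup>2 * (norm x)\<^sup>2 / 4"
  proof -
    have "of_real ((norm x)\<^sup>2) / (4 * \<omega>) = of_real ((norm x)\<^sup>2 / 4) * inverse \<omega>"
      by (simp add: field_simps)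
    moreover have "Re (inverse \<omega>) = Re \<omega> / (cmod \<omega>)\<^sup>2"
      by (simp add: cmod_power2)
    ultimately show ?thesis
      by (simp only: times_complex.sel Re_complex_of_real Im_complex_of_real) (simp add: mult_ac)
  qed
  ultimately show ?thesis
    unfolding gauss_kernel_def norm_mult norm_exp_eq_Re by simp
qed

lemma Lq_norm_gauss_le:
  assumes "K \<ge> 0" "a > 0" "r \<ge> 1"
  shows "Lq_norm r (\<lambda>x::real^'n. of_real (K * exp (- (a * (norm x)\<^sup>2))))
    \<le> ennreal (K * (if r = \<infinity> then 1 else (pi / (enn2real r * a)) powr (real CARD('n) / (2 * enn2real r))))"
proof (cases "r = \<infinity>")
  case True
  have "Lq_norm \<infinity> (\<lambda>x::real^'n. of_real (K * exp (- (a * (norm x)\<^sup>2)))) \<le> ennreal K"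
    by (intro Lq_norm_infinity_le measurable_completion)
      (use assms in \<open>auto intro!: ennreal_leI simp: norm_mult mult_left_le\<close>)
  then show ?thesis using True by simp
next
  case False
  then obtain r' where r: "r = ennreal r'" "r' \<ge> 0" by (cases r) auto
  then have r': "r' \<ge> 1" using assms by simp
  have "(\<integral>\<^sup>+x. ennreal (cmod (of_real (K * exp (- (a * (norm x)\<^sup>2)))) powr r') \<partial>(lborel :: (real^'n) measure))
      = (\<integral>\<^sup>+x. ennreal (K powr r') * ennreal (exp (- (r' * a * (norm x)\<^sup>2))) \<partial>(lborel :: (real^'n) measure))"
    using assms by (simp add: norm_mult powr_mult exp_powr_real mult_ac flip: ennreal_mult)
  also have "\<dots> = ennreal (K powr r') * ennreal ((pi / (r' * a)) powr (real CARD('n) / 2))"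
    using assms r' by (subst nn_integral_cmult) (simp_all add: nn_integral_gauss)
  also have "\<dots> = ennreal ((K * (pi / (r' * a)) powr (real CARD('n) / (2 * r'))) powr r')"
    using assms r' by (simp add: powr_mult powr_powr flip: ennreal_mult)
  finally show ?thesis
    using Lq_norm_le_iff[of r' "K * (pi / (r' * a)) powr (real CARD('n) / (2 * r'))"
        "\<lambda>x::real^'n. of_real (K * exp (- (a * (norm x)\<^sup>2)))"] assms r r' False by simp
qed

text \<open>The kernel is bounded by \<open>K\<close> and integrable. Hence, for finite
  \<open>q\<close>, the product is at most the kernel where |\<phi>| \<le> 1, and at most
  \<open>K\<close> times |\<phi>|^q elsewhere. Integrability lets the two terms of the commutator
  merge into one integral.\<close>

lemma integrable_gauss_kernel_mult:
  fixes \<phi> :: "real^'n \<Rightarrow> complex"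
  assumes \<omega>: "Re \<omega> > 0" and [measurable]: "\<phi> \<in> borel_measurable borel"
    and q: "q \<ge> 1" and fin: "Lq_norm q \<phi> < \<infinity>"
  shows "integrable lborel (\<lambda>y. gauss_kernel \<omega> (x - y) * \<phi> y)"
proof -
  define K where "K = (4 * pi * cmod \<omega>) powr (- (real CARD('n) / 2))"
  define a where "a = Re \<omega> / (cmod \<omega>)\<^sup>2 / 4"
  have "\<omega> \<noteq> 0" using \<omega> by auto
  then have a: "a > 0" using \<omega> by (simp add: a_def)
  have G: "cmod (gauss_kernel \<omega> y) = K * exp (- (a * (norm y)\<^sup>2))" for y :: "real^'n"
    using cmod_gauss_kernel[OF \<omega>, of y] by (simp add: K_def a_def)
  have "(\<integral>\<^sup>+y. ennreal (cmod (gauss_kernel \<omega> y)) \<partial>(lborel :: (real^'n) measure)) < \<infinity>"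
    using nn_integral_gauss[OF a, where 'a = "real^'n"]
    by (simp add: G ennreal_mult nn_integral_cmult ennreal_mult_less_top K_def)
  then have int_G: "(\<integral>\<^sup>+y. ennreal (cmod (gauss_kernel \<omega> (x - y))) \<partial>lborel) < \<infinity>"
    using nn_integral_lborel_reflect[of "\<lambda>y. ennreal (cmod (gauss_kernel \<omega> y))" x] by simp
  have "(\<integral>\<^sup>+y. ennreal (cmod (gauss_kernel \<omega> (x - y)) * cmod (\<phi> y)) \<partial>lborel) < \<infinity>"
  proof (cases "q = \<infinity>")
    case True
    have "Lq_norm 1 (\<lambda>y. gauss_kernel \<omega> (x - y)) < \<infinity>"
      using int_G by (auto simp: Lq_norm_def nn_integral_completion Let_def)
    then have "Lq_norm \<infinity> \<phi> * Lq_norm 1 (\<lambda>y. gauss_kernel \<omega> (x - y)) < \<infinity>"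
      using fin True by (simp add: ennreal_mult_less_top)
    then show ?thesis
      using nn_integral_mult_le_Lq_norm_infinity[of "\<lambda>y. gauss_kernel \<omega> (x - y)" \<phi>]
      by (simp add: mult.commute order_le_less_trans)
  next
    case False
    then obtain q' where q': "q = ennreal q'" "q' \<ge> 1" using q by (cases q) auto
    have "(\<integral>\<^sup>+y. ennreal (cmod (\<phi> y) powr q') \<partial>lborel) < \<infinity>"
      using fin q' by (auto simp: Lq_norm_def nn_integral_completion Let_def less_top split: if_splits)
    then have fin': "(\<integral>\<^sup>+y. ennreal (cmod (gauss_kernel \<omega> (x - y))) \<partial>lborel)
        + ennreal K * (\<integral>\<^sup>+y. ennreal (cmod (\<phi> y) powr q') \<partial>lborel) < \<infinity>"
      using int_G by (simp add: ennreal_mult_less_top)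
    have "cmod (gauss_kernel \<omega> (x - y)) * cmod (\<phi> y)
        \<le> cmod (gauss_kernel \<omega> (x - y)) + K * cmod (\<phi> y) powr q'" for y
    proof (cases "cmod (\<phi> y) \<le> 1")
      case True
      then show ?thesis
        by (intro order_trans[OF mult_left_le]) (auto simp: K_def)
    next
      case False
      have "cmod (gauss_kernel \<omega> (x - y)) \<le> K"
        using a unfolding G K_def by (intro mult_left_le) auto
      moreover have "cmod (\<phi> y) \<le> cmod (\<phi> y) powr q'"
        using powr_mono[of 1 q' "cmod (\<phi> y)"] False q' by simp
      ultimately have "cmod (gauss_kernel \<omega> (x - y)) * cmod (\<phi> y) \<le> K * cmod (\<phi> y) powr q'"
        by (intro mult_mono) (auto simp: K_def)
      then show ?thesis by (simp add: add_increasing)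
    qed
    then have "(\<integral>\<^sup>+y. ennreal (cmod (gauss_kernel \<omega> (x - y)) * cmod (\<phi> y)) \<partial>lborel)
        \<le> (\<integral>\<^sup>+y. ennreal (cmod (gauss_kernel \<omega> (x - y))) + ennreal K * ennreal (cmod (\<phi> y) powr q') \<partial>lborel)"
      by (intro nn_integral_mono) (simp add: K_def flip: ennreal_mult ennreal_plus)
    also have "\<dots> = (\<integral>\<^sup>+y. ennreal (cmod (gauss_kernel \<omega> (x - y))) \<partial>lborel)
        + ennreal K * (\<integral>\<^sup>+y. ennreal (cmod (\<phi> y) powr q') \<partial>lborel)"
      by (simp add: nn_integral_add nn_integral_cmult)
    finally show ?thesis using fin' by (rule order_le_less_trans)
  qed
  then show ?thesis
    by (intro integrableI_bounded) (simp_all add: norm_mult)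
qed

lemma borel_measurable_heat_op:
  fixes \<phi> :: "real^'n \<Rightarrow> complex"
  assumes [measurable]: "\<phi> \<in> borel_measurable borel"
  shows "heat_op \<omega> \<phi> \<in> borel_measurable borel"
proof -
  have "heat_op \<omega> \<phi> = (\<lambda>x. LINT y|lborel. gauss_kernel \<omega> (x - y) * \<phi> y)"
    unfolding heat_op_def convol_def by (subst integral_completion) simp_all
  then show ?thesis by simp
qed

section \<open>Passing to Borel representatives\<close>

lemma heat_op_cong_AE:
  fixes \<phi> \<psi> :: "real^'n \<Rightarrow> complex"
  assumes [measurable]: "\<phi> \<in> borel_measurable lebesgue" "\<psi> \<in> borel_measurable lebesgue"
    and "AE x in lebesgue. \<phi> x = \<psi> x"
  shows "heat_op \<omega> \<phi> = heat_op \<omega> \<psi>"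
proof -
  have [measurable]: "(\<lambda>y::real^'n. gauss_kernel \<omega> (x - y)) \<in> borel_measurable lebesgue" for x
    by (rule measurable_completion) measurable
  show ?thesis
    unfolding heat_op_def convol_def
    by (intro ext integral_cong_AE) (use assms(3) in auto)
qed

text \<open>The convolution estimates are proved for Borel functions, where reflections and Tonelli
  on \<open>lborel\<close> raise no measurability problem. This lemma carries them over to Lebesgue
  measurable functions.\<close>

lemma lebesgue_measurable_ex_borel:
  fixes \<phi> :: "'a::euclidean_space \<Rightarrow> complex"
  assumes "\<phi> \<in> borel_measurable lebesgue"
  obtains \<psi> where "\<psi> \<in> borel_measurable borel" "AE x in lebesgue. \<phi> x = \<psi> x"
proof -
  have "(\<lambda>x. Re (\<phi> x)) \<in> borel_measurable lebesgue" "(\<lambda>x. Im (\<phi> x)) \<in> borel_measurable lebesgue"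
    using assms by measurable
  then obtain u v where uv: "u \<in> borel_measurable lborel" "v \<in> borel_measurable lborel"
    "AE x in lborel. Re (\<phi> x) = u x" "AE x in lborel. Im (\<phi> x) = v x"
    using completion_ex_borel_measurable_real by metis
  show ?thesis
  proof (rule that[of "\<lambda>x. Complex (u x) (v x)"])
    show "(\<lambda>x. Complex (u x) (v x)) \<in> borel_measurable borel"
      using uv(1,2) unfolding Complex_eq by measurable
    show "AE x in lebesgue. \<phi> x = Complex (u x) (v x)"
      using uv(3,4) by (intro AE_completion, eventually_elim) (simp add: complex_eq_iff)
  qed
qed

text \<open>The pointwise domination. Here \<open>s\<close> is the length scale of the kernel,
  \<open>a\<close> is dimensionless, and \<open>c / 8\<close> is the rate of the half of the decay
  that is kept. The integrand has the shape that \<open>young_convolution\<close> expects.\<close>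

lemma cmod_heat_commutator_le:
  fixes \<phi> :: "real^'n \<Rightarrow> complex" and \<omega> :: complex and m :: nat
  defines "K \<equiv> (4 * pi * cmod \<omega>) powr (- (real CARD('n) / 2))"
    and "c \<equiv> Re \<omega> / (cmod \<omega>)\<^sup>2" and "s \<equiv> sqrt (cmod \<omega>)"
    and "a \<equiv> sqrt (4 * real m / (exp 1 * (Re \<omega> / cmod \<omega>)))"
  assumes \<omega>: "Re \<omega> > 0" and [measurable]: "\<phi> \<in> borel_measurable borel" and q: "q \<ge> 1"
    and fin: "Lq_norm q \<phi> < \<infinity>" "Lq_norm q (mono_mult \<alpha> \<phi>) < \<infinity>" and m: "mi_abs \<alpha> = m"
  shows "ennreal (cmod (heat_commutator \<alpha> \<omega> \<phi> x))
    \<le> (\<integral>\<^sup>+y. ennreal (cmod (of_real (K * exp (- (c / 8 * (norm (x - y))\<^sup>2))))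
        * cmod (of_real (((a + 1) ^ m - 1)) * (of_real (s * norm y ^ (m - 1) + s ^ m) * \<phi> y))) \<partial>lborel)"
proof -
  have \<omega>0: "cmod \<omega> > 0" using \<omega> by auto
  then have c: "c > 0" and s: "s > 0" and a: "a \<ge> 0" and K: "K \<ge> 0"
    using \<omega> by (auto simp: c_def s_def a_def K_def)
  \<comment> \<open>Since \<open>c\<close> is (Re \<omega> / |\<omega>|) / s^2, the base in
    \<open>power_times_gauss_le\<close> splits into \<open>a\<close> and the scale
    \<open>s\<close>.\<close>
  have as: "a * s = sqrt (4 * real m / (exp 1 * c))"
    using \<omega> \<omega>0 by (simp add: a_def s_def c_def power2_eq_square flip: real_sqrt_mult)
  let ?G = "gauss_kernel \<omega> :: real^'n \<Rightarrow> complex"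
  have [measurable]: "mono_mult \<alpha> \<phi> \<in> borel_measurable borel"
    by (rule mono_mult_measurable) measurable
  have int: "integrable lborel (\<lambda>y. ?G (x - y) * \<phi> y)" "integrable lborel (\<lambda>y. ?G (x - y) * mono_mult \<alpha> \<phi> y)"
    using \<omega> q fin by (auto intro: integrable_gauss_kernel_mult)
  have diff: "of_real (mono_pow x \<alpha>) * (?G (x - y) * \<phi> y) - ?G (x - y) * mono_mult \<alpha> \<phi> y
      = of_real (mono_pow x \<alpha> - mono_pow y \<alpha>) * ?G (x - y) * \<phi> y" for y
    by (simp add: mono_mult_def algebra_simps)
  have "integrable lborel (\<lambda>y. of_real (mono_pow x \<alpha>) * (?G (x - y) * \<phi> y) - ?G (x - y) * mono_mult \<alpha> \<phi> y)"
    using int by simp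
  then have int_diff: "integrable lborel (\<lambda>y. of_real (mono_pow x \<alpha> - mono_pow y \<alpha>) * ?G (x - y) * \<phi> y)"
    by (simp only: diff)
  have "heat_commutator \<alpha> \<omega> \<phi> x
      = of_real (mono_pow x \<alpha>) * (LINT y|lborel. ?G (x - y) * \<phi> y) - (LINT y|lborel. ?G (x - y) * mono_mult \<alpha> \<phi> y)"
    unfolding heat_commutator_def heat_op_def convol_def
    by (simp add: integral_completion mono_mult_def[of _ "\<lambda>x. LINT y|_. _ x y"])
  also have "\<dots> = (LINT y|lborel. of_real (mono_pow x \<alpha>) * (?G (x - y) * \<phi> y) - ?G (x - y) * mono_mult \<alpha> \<phi> y)"
    using int by simp
  also have "\<dots> = (LINT y|lborel. of_real (mono_pow x \<alpha> - mono_pow y \<alpha>) * ?G (x - y) * \<phi> y)"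
    by (simp only: diff)
  finally have "cmod (heat_commutator \<alpha> \<omega> \<phi> x) = cmod \<dots>" by simp
  then have "ennreal (cmod (heat_commutator \<alpha> \<omega> \<phi> x))
      \<le> (\<integral>\<^sup>+y. ennreal (cmod (of_real (mono_pow x \<alpha> - mono_pow y \<alpha>) * ?G (x - y) * \<phi> y)) \<partial>lborel)"
    by (simp only: integral_norm_bound_ennreal[OF int_diff])
  also have "\<dots> \<le> (\<integral>\<^sup>+y. ennreal (cmod (of_real (K * exp (- (c / 8 * (norm (x - y))\<^sup>2))))
        * cmod (of_real (((a + 1) ^ m - 1)) * (of_real (s * norm y ^ (m - 1) + s ^ m) * \<phi> y))) \<partial>lborel)"
  proof (intro nn_integral_mono ennreal_leI)
    fix y :: "real^'n"
    define Z where "Z = norm (x - y)"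
    have G: "cmod (?G (x - y)) = K * exp (- (c * Z\<^sup>2 / 4))"
      using cmod_gauss_kernel[OF \<omega>, of "x - y"] by (simp add: K_def c_def Z_def)
    \<comment> \<open>The decay exp(-c Z^2/4) is cut into two equal halves, one of which absorbs the
      power of \<open>Z\<close>.\<close>
    have tail: "Z ^ l * exp (- (c * Z\<^sup>2 / 4)) \<le> (a * s) ^ l * exp (- (c * Z\<^sup>2 / 8))" if "l \<le> m" for l
    proof -
      have "Z ^ l * exp (- (c * Z\<^sup>2 / 4)) = Z ^ l * exp (- (c * Z\<^sup>2 / 8)) * exp (- (c * Z\<^sup>2 / 8))"
        by (simp flip: exp_add)
      also have "\<dots> \<le> (a * s) ^ l * exp (- (c * Z\<^sup>2 / 8))"
        unfolding as using c that by (intro mult_right_mono power_times_gauss_le) (auto simp: Z_def)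
      finally show ?thesis .
    qed
    have "\<bar>mono_pow x \<alpha> - mono_pow y \<alpha>\<bar> * exp (- (c * Z\<^sup>2 / 4))
        \<le> ((norm y + Z) ^ m - norm y ^ m) * exp (- (c * Z\<^sup>2 / 4))"
      using abs_mono_pow_diff_le[of x \<alpha> y] m by (simp add: Z_def)
    also have "\<dots> \<le> ((a + 1) ^ m - 1) * exp (- (c * Z\<^sup>2 / 8)) * (s * norm y ^ (m - 1) + s ^ m)"
      using s a tail by (intro binomial_diff_le) (auto simp: Z_def)
    finally have "\<bar>mono_pow x \<alpha> - mono_pow y \<alpha>\<bar> * exp (- (c * Z\<^sup>2 / 4)) * (K * cmod (\<phi> y))
        \<le> ((a + 1) ^ m - 1) * exp (- (c * Z\<^sup>2 / 8)) * (s * norm y ^ (m - 1) + s ^ m) * (K * cmod (\<phi> y))"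
      using K by (intro mult_right_mono) auto
    moreover have "(a + 1) ^ m - 1 \<ge> 0" "s * norm y ^ (m - 1) + s ^ m \<ge> 0"
      using a s by (auto intro!: add_nonneg_nonneg)
    ultimately show "cmod (of_real (mono_pow x \<alpha> - mono_pow y \<alpha>) * ?G (x - y) * \<phi> y)
      \<le> cmod (of_real (K * exp (- (c / 8 * (norm (x - y))\<^sup>2))))
        * cmod (of_real (((a + 1) ^ m - 1)) * (of_real (s * norm y ^ (m - 1) + s ^ m) * \<phi> y))"
      using K by (simp only: norm_mult norm_of_real G abs_mult abs_of_nonneg abs_exp_cancel Z_def[symmetric]) (simp add: mult_ac)
  qed
  finally show ?thesis .
qed

text \<open>Young's inequality for the kept Gaussian \<open>?H\<close> and the weighted function
  \<open>?w\<close>, whose norm is split by the triangle inequality. The factor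
  \<open>8 * pi\<close> is pi divided by the rate 1/8.\<close>

lemma Lq_norm_heat_commutator_le:
  fixes \<phi> :: "real^'n \<Rightarrow> complex" and \<omega> :: complex and m :: nat and p q r :: ennreal
  defines "K \<equiv> (4 * pi * cmod \<omega>) powr (- (real CARD('n) / 2))"
    and "c \<equiv> Re \<omega> / (cmod \<omega>)\<^sup>2" and "s \<equiv> sqrt (cmod \<omega>)"
    and "a \<equiv> sqrt (4 * real m / (exp 1 * (Re \<omega> / cmod \<omega>)))"
  assumes \<omega>: "Re \<omega> > 0" and \<phi>: "\<phi> \<in> borel_measurable borel"
    and pqr: "p \<ge> 1" "q \<ge> 1" "r \<ge> 1" "1 / p + 1 = 1 / r + 1 / q"
    and fin: "Lq_norm q \<phi> < \<infinity>" "Lq_norm q (mono_mult \<alpha> \<phi>) < \<infinity>" and m: "mi_abs \<alpha> = m"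
  shows "Lq_norm p (heat_commutator \<alpha> \<omega> \<phi>)
    \<le> ennreal (K * (if r = \<infinity> then 1 else (8 * pi / (enn2real r * c)) powr (real CARD('n) / (2 * enn2real r)))
          * ((a + 1) ^ m - 1))
      * (ennreal s * Lq_norm q (\<lambda>x. of_real (norm x ^ (m - 1)) * \<phi> x) + ennreal (s ^ m) * Lq_norm q \<phi>)"
proof -
  note [measurable] = \<phi>
  have "cmod \<omega> > 0" using \<omega> by auto
  then have c: "c > 0" and s: "s > 0" and a: "a \<ge> 0" and K: "K \<ge> 0"
    using \<omega> by (auto simp: c_def s_def a_def K_def)
  let ?w = "\<lambda>y. of_real (s * norm y ^ (m - 1) + s ^ m) * \<phi> y"
  let ?H = "\<lambda>x::real^'n. complex_of_real (K * exp (- (c / 8 * (norm x)\<^sup>2)))"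
  let ?D = "(a + 1) ^ m - 1"
  let ?R = "if r = \<infinity> then 1 else (8 * pi / (enn2real r * c)) powr (real CARD('n) / (2 * enn2real r))"
  have D: "?D \<ge> 0" using a by simp
  have "Lq_norm q ?w \<le> Lq_norm q (\<lambda>x. of_real s * (of_real (norm x ^ (m - 1)) * \<phi> x)) + Lq_norm q (\<lambda>x. of_real (s ^ m) * \<phi> x)"
  proof (intro Lq_norm_triangle measurable_completion)
    fix x
    show "cmod (?w x) \<le> cmod (of_real s * (of_real (norm x ^ (m - 1)) * \<phi> x)) + cmod (of_real (s ^ m) * \<phi> x)"
      by (rule order_trans[OF _ norm_triangle_ineq]) (simp add: algebra_simps)
  qed (use pqr in simp_all)
  also have "\<dots> \<le> ennreal s * Lq_norm q (\<lambda>x. of_real (norm x ^ (m - 1)) * \<phi> x) + ennreal (s ^ m) * Lq_norm q \<phi>"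
    using s pqr by (intro add_mono Lq_norm_scale measurable_completion) simp_all
  finally have w: "Lq_norm q ?w \<le> ennreal s * Lq_norm q (\<lambda>x. of_real (norm x ^ (m - 1)) * \<phi> x) + ennreal (s ^ m) * Lq_norm q \<phi>" .
  have "Lq_norm r ?H \<le> ennreal (K * (if r = \<infinity> then 1 else (pi / (enn2real r * (c / 8))) powr (real CARD('n) / (2 * enn2real r))))"
    using K c pqr by (intro Lq_norm_gauss_le) simp_all
  moreover have "pi / (t * (c / 8)) = 8 * pi / (t * c)" for t
    by simp
  ultimately have H: "Lq_norm r ?H \<le> ennreal (K * ?R)"
    by (simp only:)
  have "Lq_norm p (heat_commutator \<alpha> \<omega> \<phi>) \<le> Lq_norm r ?H * Lq_norm q (\<lambda>y. of_real ?D * ?w y)"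
  proof (rule young_convolution[OF _ _ _ _ pqr(2,1,3,4)])
    show "heat_commutator \<alpha> \<omega> \<phi> \<in> borel_measurable lebesgue"
      unfolding heat_commutator_def
      by (intro measurable_completion borel_measurable_diff)
        (auto intro: mono_mult_measurable borel_measurable_heat_op \<phi>)
    show "ennreal (cmod (heat_commutator \<alpha> \<omega> \<phi> x)) \<le> (\<integral>\<^sup>+y. ennreal (cmod (?H (x - y)) * cmod (of_real ?D * ?w y)) \<partial>lborel)" for x
      using cmod_heat_commutator_le[OF \<omega> \<phi> pqr(2) fin m, of x]
      by (simp only: K_def c_def s_def a_def)
  qed measurable
  also have "\<dots> \<le> ennreal (K * ?R) * (ennreal ?D * Lq_norm q ?w)"
    using D pqr by (intro mult_mono H Lq_norm_scale measurable_completion) simp_all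
  also have "\<dots> = ennreal (K * ?R * ?D) * Lq_norm q ?w"
    using K D by (subst ennreal_mult) (simp_all add: mult.assoc)
  also have "\<dots> \<le> ennreal (K * ?R * ?D) * (ennreal s * Lq_norm q (\<lambda>x. of_real (norm x ^ (m - 1)) * \<phi> x) + ennreal (s ^ m) * Lq_norm q \<phi>)"
    by (intro mult_left_mono w) simp
  finally show ?thesis .
qed

text \<open>Used with w = |\<omega>| and C = cos \<theta>. Factoring \<open>4 * pi * w\<close> out
  of the second base merges its power with the prefactor, and the exponents combine to -(n/2)(1 -
  1/R).\<close>

lemma gauss_constant_eq:
  fixes w C R n d :: real
  assumes "w > 0" "C > 0" "R > 0" "d = 1 - 1 / R"
  shows "(4 * pi * w) powr (- (n / 2)) * (8 * pi / (R * (C / w))) powr (n / (2 * R))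
    = (4 * pi) powr (- (n / 2) * d) * (2 / (R * C)) powr (n / (2 * R)) * w powr (- (n / 2) * d)"
proof -
  have "8 * pi / (R * (C / w)) = (4 * pi * w) * (2 / (R * C))"
    using assms by (simp add: field_simps)
  then have "(4 * pi * w) powr (- (n / 2)) * (8 * pi / (R * (C / w))) powr (n / (2 * R))
      = (4 * pi * w) powr (- (n / 2) + n / (2 * R)) * (2 / (R * C)) powr (n / (2 * R))"
    using assms by (simp only: powr_add powr_mult mult.assoc mult.left_commute mult.commute)
  also have "- (n / 2) + n / (2 * R) = - (n / 2) * d"
    using assms(3) by (simp add: assms(4) field_simps)
  finally show ?thesis
    using assms by (simp add: powr_mult)
qed

theorem theorem1p2:
  fixes \<omega> :: complex and p q r :: ennreal and m :: nat and \<theta> :: real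
    and \<phi> :: "real^'n \<Rightarrow> complex"
  assumes "Re \<omega> > 0"
    and "1 \<le> q" and "q \<le> p"
    and "m > 0"
    and "- pi / 2 < \<theta>" and "\<theta> < pi / 2"
    and "exp (\<i> * of_real \<theta>) = \<omega> / of_real (cmod \<omega>)"
    and "1 \<le> r" and "1 / p + 1 = 1 / r + 1 / q"
    and "\<phi> \<in> Lq_weighted q m"
  shows "(\<Sum>\<alpha> | mi_abs \<alpha> = m. Lq_norm p (heat_commutator \<alpha> \<omega> \<phi>))
    \<le> ennreal (A_const CARD('n) m r \<theta>
          * cmod \<omega> powr (- (real CARD('n) / 2) * (enn2real (1 / q) - enn2real (1 / p))))
      * (ennreal (cmod \<omega> powr (1 / 2))
           * Lq_norm q (\<lambda>x. of_real (norm x ^ (m - 1)) * \<phi> x)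
         + ennreal (cmod \<omega> powr (real m / 2)) * Lq_norm q \<phi>)"
proof -
  define n where "n = real CARD('n)"
  define K where "K = (4 * pi * cmod \<omega>) powr (- (n / 2))"
  define c where "c = Re \<omega> / (cmod \<omega>)\<^sup>2"
  define s where "s = sqrt (cmod \<omega>)"
  define a where "a = sqrt (4 * real m / (exp 1 * (Re \<omega> / cmod \<omega>)))"
  define R where "R = (if r = \<infinity> then 1 else (8 * pi / (enn2real r * c)) powr (n / (2 * enn2real r)))"
  have p: "p \<ge> 1" using assms(2,3) by (rule order_trans)
  have \<omega>: "cmod \<omega> > 0" using assms(1) by auto
  \<comment> \<open>The angle enters the estimates only through its cosine, which is Re \<omega> /
    |\<omega>|.\<close>
  have "cos \<theta> = Re (exp (\<i> * of_real \<theta>))"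
    by (simp add: Re_exp)
  then have cos: "cos \<theta> = Re \<omega> / cmod \<omega>"
    by (simp add: assms(7))
  then have cos_pos: "cos \<theta> > 0" using assms(1) \<omega> by simp
  have mono: "mono_mult \<alpha> \<phi> \<in> borel_measurable lebesgue" "Lq_norm q (mono_mult \<alpha> \<phi>) < \<infinity>"
    if "mi_abs \<alpha> = m" for \<alpha> :: "'n \<Rightarrow> nat"
    using assms(10) that by (auto simp: Lq_weighted_def Lq_space_def)
  have \<phi>: "\<phi> \<in> borel_measurable lebesgue" "Lq_norm q \<phi> < \<infinity>"
    using assms(10) by (auto simp: Lq_weighted_def Lq_space_def)
  \<comment> \<open>Replacing \<phi> by a Borel representative \<psi> leaves the commutator
    unchanged at every point and all norms involved unchanged.\<close>
  obtain \<psi> where \<psi>: "\<psi> \<in> borel_measurable borel" and ae: "AE x in lebesgue. \<phi> x = \<psi> x"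
    using lebesgue_measurable_ex_borel[OF \<phi>(1)] by blast
  have \<psi>': "\<psi> \<in> borel_measurable lebesgue"
    using \<psi> by (intro measurable_completion) simp
  have weight: "(\<lambda>x::real^'n. complex_of_real (norm x ^ (m - 1))) \<in> borel_measurable lebesgue"
    by (rule measurable_completion) measurable
  have norm_\<psi>: "Lq_norm q \<psi> = Lq_norm q \<phi>"
    using ae by (intro Lq_norm_AE_cong \<phi> \<psi>', eventually_elim) simp
  have "AE x in lebesgue. cmod (of_real (norm x ^ (m - 1)) * \<psi> x) = cmod (of_real (norm x ^ (m - 1)) * \<phi> x)"
    using ae by eventually_elim simp
  then have norm_w: "Lq_norm q (\<lambda>x. of_real (norm x ^ (m - 1)) * \<psi> x) = Lq_norm q (\<lambda>x. of_real (norm x ^ (m - 1)) * \<phi> x)"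
    by (intro Lq_norm_AE_cong borel_measurable_times weight \<phi>(1) \<psi>')
  let ?N = "ennreal s * Lq_norm q (\<lambda>x. of_real (norm x ^ (m - 1)) * \<phi> x) + ennreal (s ^ m) * Lq_norm q \<phi>"
  have le: "Lq_norm p (heat_commutator \<alpha> \<omega> \<phi>) \<le> ennreal (K * R * ((a + 1) ^ m - 1)) * ?N"
    if \<alpha>: "mi_abs \<alpha> = m" for \<alpha> :: "'n \<Rightarrow> nat"
  proof -
    have mono_\<psi>: "mono_mult \<alpha> \<psi> \<in> borel_measurable lebesgue"
      using \<psi> by (intro measurable_completion) (simp add: mono_mult_measurable)
    have ae_mono: "AE x in lebesgue. mono_mult \<alpha> \<phi> x = mono_mult \<alpha> \<psi> x"
      using ae by eventually_elim (simp add: mono_mult_def)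
    have "heat_commutator \<alpha> \<omega> \<phi> = heat_commutator \<alpha> \<omega> \<psi>"
      unfolding heat_commutator_def
      using heat_op_cong_AE[OF \<phi>(1) \<psi>' ae] heat_op_cong_AE[OF mono(1)[OF \<alpha>] mono_\<psi> ae_mono] by simp
    moreover have "Lq_norm q (mono_mult \<alpha> \<psi>) = Lq_norm q (mono_mult \<alpha> \<phi>)"
      using ae_mono by (intro Lq_norm_AE_cong mono mono_\<psi> \<alpha>, eventually_elim) simp
    ultimately show ?thesis
      using Lq_norm_heat_commutator_le[OF assms(1) \<psi> p assms(2,8,9) _ _ \<alpha>] \<phi> mono[OF \<alpha>]
      by (simp only: norm_\<psi> norm_w K_def R_def a_def s_def c_def n_def)
  qed
  \<comment> \<open>Reciprocals of exponents at least 1 are finite, so the relation passes from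
    \<open>ennreal\<close> to the reals.\<close>
  have enn: "enn2real (1 / p) + 1 = enn2real (1 / r) + enn2real (1 / q)"
  proof -
    have fin: "1 / t < top" if "t \<ge> 1" for t :: ennreal
      using that by (cases t) (auto simp: one_divide_ennreal)
    show ?thesis
      using enn2real_plus[OF fin[OF p], of 1] enn2real_plus[OF fin[OF assms(8)] fin[OF assms(2)]]
      by (simp add: assms(9))
  qed
  have s_half: "s = cmod \<omega> powr (1 / 2)"
    using \<omega> by (simp add: s_def powr_half_sqrt)
  then have s_pow: "s ^ m = cmod \<omega> powr (real m / 2)"
    using \<omega> by (simp add: powr_powr flip: powr_realpow)
  have KR: "K * R = (4 * pi) powr (- (n / 2) * (1 - enn2real (1 / r)))
     * (if r = \<infinity> then 1 else (2 / (enn2real r * cos \<theta>)) powr (n / (2 * enn2real r)))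
     * cmod \<omega> powr (- (n / 2) * (enn2real (1 / q) - enn2real (1 / p)))"
  proof (cases "r = \<infinity>")
    case True
    \<comment> \<open>For r = \<infinity> the exponent relation gives 1/q - 1/p = 1, so the power of
      |\<omega>| is exactly the one in \<open>K\<close>.\<close>
    moreover have "enn2real (1 / q) - enn2real (1 / p) = 1"
      using enn True by simp
    ultimately show ?thesis
      using \<omega> by (simp add: K_def R_def powr_mult)
  next
    case False
    then obtain r' where r': "r = ennreal r'" "r' \<ge> 1"
      using assms(8) by (cases r) auto
    have "enn2real (1 / q) - enn2real (1 / p) = 1 - 1 / r'" "enn2real (1 / r) = 1 / r'"
      using enn r' by (simp_all add: one_divide_ennreal)
    moreover have "c = cos \<theta> / cmod \<omega>"
      by (simp add: c_def cos power2_eq_square)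
    ultimately show ?thesis
      using gauss_constant_eq[OF \<omega> cos_pos, of r' "1 - 1 / r'" n] r' False
      by (simp add: K_def R_def)
  qed
  have card: "real (card {\<alpha>::'n \<Rightarrow> nat. mi_abs \<alpha> = m}) = fact (CARD('n) + m - 1) / (fact (CARD('n) - 1) * fact m)"
  proof -
    \<comment> \<open>Writing the dimension as a successor resolves the truncated subtractions in
      the factorials.\<close>
    obtain k where "CARD('n) = Suc k"
      using zero_less_card_finite[where 'a='n] gr0_implies_Suc by blast
    then show ?thesis
      unfolding card_mi_abs by (simp add: binomial_fact add.commute mult.commute)
  qed
  have A: "real (card {\<alpha>::'n \<Rightarrow> nat. mi_abs \<alpha> = m}) * (K * R * ((a + 1) ^ m - 1))
      = A_const CARD('n) m r \<theta> * cmod \<omega> powr (- (n / 2) * (enn2real (1 / q) - enn2real (1 / p)))"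
    unfolding KR card A_const_def a_def cos n_def by (simp add: mult_ac)
  have "(\<Sum>\<alpha> | mi_abs \<alpha> = m. Lq_norm p (heat_commutator \<alpha> \<omega> \<phi>))
      \<le> (\<Sum>\<alpha>::'n \<Rightarrow> nat | mi_abs \<alpha> = m. ennreal (K * R * ((a + 1) ^ m - 1)) * ?N)"
    using le by (intro sum_mono) simp
  also have "\<dots> = ennreal (real (card {\<alpha>::'n \<Rightarrow> nat. mi_abs \<alpha> = m}) * (K * R * ((a + 1) ^ m - 1))) * ?N"
    by (simp add: ennreal_mult' ennreal_of_nat_eq_real_of_nat mult.assoc)
  finally show ?thesis
    unfolding A s_pow n_def by (simp only: s_half)
qed

end
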